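(* Let $G$ be a finite connected multigraph (loops and multiple edges allowed) with vertex set $\{0,1,\dots,n\}$, let $\tau\in S_n$ be a vertex ranking, and let $T_G(x,y)$ be the Tutte polynomial of $G$. Then $$T_G(x,y)=\sum_{f\in\mathcal{P}_G}x^{b(f)}y^{w(f)},$$ where $b(f)=b_{G,\tau}(f)$ is the number of $f$-bridge vertices and $w(f)=|E(G)|-|V(G)|-\sum_{i=0}^n f(i)$.
   Context: Let $G$ be a finite connected multigraph with vertex set $V(G)=\{0,1,\dots,n\}$ and edge set $E(G)$. For vertices $a,b$ let $\mu_G(a,b)$ be the number of edges joining $a$ and $b$. For $I\subseteq V(G)\setminus\{0\}$ and $v\in I$, $\mathrm{outdeg}_{I,G}(v)$ is the number of edges $\{w,v\}\in E(G)$ with $w\notin I$ (loops are never counted). A $G$-parking function is a function $f:V(G)\to\mathbb{N}\cup\{-1\}$ with $f(0)=-1$ such that for every nonempty $I\subseteq V(G)\setminus\{0\}$ there is $v\in I$ with $0\le f(v)<\mathrm{outdeg}_{I,G}(v)$; $\mathcal{P}_G$ denotes the set of $G$-parking functions. A vertex ranking is a permutation $\tau$ of $[n]=\{1,\dots,n\}$; vertex $0$ is regarded as ranked before all others. For $f\in\mathcal{P}_G$ the order $\mathrm{Ord}(f)$ is produced by the following procedure: set $val=f$, $P=\emptyset$, $Q=\{0\}$; repeatedly, let $v$ be the element of $Q$ of smallest rank; for each vertex $w\notin P\cup Q$, if $0\le val(w)<\mu_G(w,v)$ add $w$ to $Q$, and otherwise replace $val(w)$ by $val(w)-\mu_G(w,v)$;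 then move $v$ from $Q$ to $P$; continue until all vertices are in $P$. If $v_0=0,v_1,\dots,v_n$ is the order in which vertices are moved into $P$, put $\mathrm{Ord}(f)_i=v_i$, $\mathrm{Ord}(f)^{-1}(v_i)=i$, and $\mathrm{Rea}(f)(i)=f(\mathrm{Ord}(f)_i)$ for $i\in[n]$. For $v\in[n]$ with $\mathrm{Ord}(f)_i=v$, let $I_v=\{\mathrm{Ord}(f)_j: j\ge i\}$. The vertex $v$ is $f$-critical if $f(v)=\mathrm{outdeg}_{I_v,G}(v)-1$. A $G$-parking function $g$ is weak $v$-identical to $f$ if (1) $\mathrm{Rea}(g)(j)=\mathrm{Rea}(f)(j)$ and $\mathrm{Ord}(g)_j=\mathrm{Ord}(f)_j$ for all $j\in[i-1]$; (2) $g(v)\ge f(v)$; (3) $g(w)\ge \mathrm{outdeg}_{I_v,G}(w)$ for all $w\in I_v$ with $\tau(w)<\tau(v)$. It is strong $v$-identical to $f$ if moreover $\mathrm{Ord}(g)_i=v$. Let $W_{v,f}$ and $S_{v,f}$ be the sets of $G$-parking functions that are weak, resp. strong, $v$-identical to $f$. A vertex $v\in V(G)\setminus\{0\}$ is an $f$-bridge vertex if $v$ is $f$-critical and $|W_{v,f}|=|S_{v,f}|$. $B(f)=B_{G,\tau}(f)$ is the set of $f$-bridge vertices and $b(f)=|B(f)|$. The Tutte polynomial is the standard one: $T_G(x,y)=\sum_{A\subseteq E(G)}(x-1)^{r(E(G))-r(A)}(y-1)^{|A|-r(A)}$, $r$ the graphic rank function. *)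

theory Defs
  imports
    "HOL-Library.Uprod"
    "HOL-Library.FuncSet"
    "HOL-Combinatorics.Permutations"
    "HOL-Computational_Algebra.Polynomial"
begin

text \<open>
  Multigraphs have labelled edges, so that parallel edges and parallel loops are distinct.
  A loop at \<open>v\<close> is an edge \<open>e\<close> with \<open>ends G e = Upair v v\<close>.
\<close>

record 'e multigraph =
  verts :: "nat set"
  edges :: "'e set"
  ends :: "'e \<Rightarrow> nat uprod"

definition finite_multigraph :: "'e multigraph \<Rightarrow> bool" where
  "finite_multigraph G \<longleftrightarrow>
     finite (verts G) \<and> finite (edges G) \<and> (\<forall>e\<in>edges G. set_uprod (ends G e) \<subseteq> verts G)"

definition adj_rel :: "'e multigraph \<Rightarrow> 'e set \<Rightarrow> (nat \<times> nat) set" where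
  "adj_rel G A = {(u, v). \<exists>e\<in>A. ends G e = Upair u v}"

definition conn_rel :: "'e multigraph \<Rightarrow> 'e set \<Rightarrow> (nat \<times> nat) set" where
  "conn_rel G A = (adj_rel G A)\<^sup>* \<inter> verts G \<times> verts G"

definition connected_multigraph :: "'e multigraph \<Rightarrow> bool" where
  "connected_multigraph G \<longleftrightarrow>
     verts G \<noteq> {} \<and> (\<forall>u\<in>verts G. \<forall>v\<in>verts G. (u, v) \<in> conn_rel G (edges G))"

text \<open>The rank of \<open>A\<close> is \<open>|V|\<close> minus the number of connected components of \<open>(V, A)\<close>.\<close>

definition graphic_rank :: "'e multigraph \<Rightarrow> 'e set \<Rightarrow> nat" where
  "graphic_rank G A = card (verts G) - card (verts G // conn_rel G A)"

text \<open>
  The ring of polynomials in \<open>x\<close> and \<open>y\<close> with integer coefficients is represented by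
  \<open>int poly poly\<close>, with \<open>y\<close> as the outer indeterminate.
\<close>

definition var_x :: "int poly poly" where
  "var_x = [:[:0, 1:]:]"

definition var_y :: "int poly poly" where
  "var_y = [:0, 1:]"

definition tutte_poly :: "'e multigraph \<Rightarrow> int poly poly" where
  "tutte_poly G =
     (\<Sum>A\<in>Pow (edges G). (var_x - 1) ^ (graphic_rank G (edges G) - graphic_rank G A)
                           * (var_y - 1) ^ (card A - graphic_rank G A))"

definition mu :: "'e multigraph \<Rightarrow> nat \<Rightarrow> nat \<Rightarrow> nat" where
  "mu G a b = card {e \<in> edges G. ends G e = Upair a b}"

text \<open>Used for \<open>v \<in> I\<close> only, in which case loops at \<open>v\<close> are not counted.\<close>

definition outdeg :: "'e multigraph \<Rightarrow> nat set \<Rightarrow> nat \<Rightarrow> nat" where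
  "outdeg G I v = card {e \<in> edges G. \<exists>w. w \<notin> I \<and> ends G e = Upair w v}"

definition parking_functions :: "'e multigraph \<Rightarrow> (nat \<Rightarrow> int) set" where
  "parking_functions G =
     {f \<in> verts G \<rightarrow>\<^sub>E insert (- 1) \<nat>. f 0 = - 1 \<and>
        (\<forall>I. I \<subseteq> verts G - {0} \<and> I \<noteq> {} \<longrightarrow> (\<exists>v\<in>I. 0 \<le> f v \<and> f v < int (outdeg G I v)))}"

text \<open>
  A ranking \<open>\<tau>\<close> gives vertex \<open>v\<close> the rank \<open>\<tau> v\<close>. If \<open>\<tau> permutes {1..n}\<close>, then \<open>\<tau> 0 = 0\<close>, so
  vertex 0 is ranked before all others.

  A state consists of the current values \<open>val\<close>, the list of the elements of \<open>P\<close> in the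
  order in which they were moved there, and the set \<open>Q\<close>. One round moves exactly one vertex
  from \<open>Q\<close> to \<open>P\<close>, so all vertices are in \<open>P\<close> after \<open>card (verts G)\<close> rounds. For a parking
  function, \<open>Q\<close> is nonempty at the start of each of these rounds.
\<close>

type_synonym ord_state = "(nat \<Rightarrow> int) \<times> nat list \<times> nat set"

definition ord_step :: "'e multigraph \<Rightarrow> (nat \<Rightarrow> nat) \<Rightarrow> ord_state \<Rightarrow> ord_state" where
  "ord_step G \<tau> = (\<lambda>(val, P, Q).
     let v = arg_min_on \<tau> Q;
         U = verts G - (set P \<union> Q);
         N = {w \<in> U. 0 \<le> val w \<and> val w < int (mu G w v)}
     in (\<lambda>w. if w \<in> U - N then val w - int (mu G w v) else val w, P @ [v], (Q - {v}) \<union> N))"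

definition Ord :: "'e multigraph \<Rightarrow> (nat \<Rightarrow> nat) \<Rightarrow> (nat \<Rightarrow> int) \<Rightarrow> nat \<Rightarrow> nat" where
  "Ord G \<tau> f i = fst (snd ((ord_step G \<tau> ^^ card (verts G)) (f, [], {0}))) ! i"

definition Ord_inv :: "'e multigraph \<Rightarrow> (nat \<Rightarrow> nat) \<Rightarrow> (nat \<Rightarrow> int) \<Rightarrow> nat \<Rightarrow> nat" where
  "Ord_inv G \<tau> f v = the_inv_into {..<card (verts G)} (Ord G \<tau> f) v"

definition Rea :: "'e multigraph \<Rightarrow> (nat \<Rightarrow> nat) \<Rightarrow> (nat \<Rightarrow> int) \<Rightarrow> nat \<Rightarrow> int" where
  "Rea G \<tau> f i = f (Ord G \<tau> f i)"

definition tail_set :: "'e multigraph \<Rightarrow> (nat \<Rightarrow> nat) \<Rightarrow> (nat \<Rightarrow> int) \<Rightarrow> nat \<Rightarrow> nat set" where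
  "tail_set G \<tau> f v = Ord G \<tau> f ` {Ord_inv G \<tau> f v..<card (verts G)}"

definition critical :: "'e multigraph \<Rightarrow> (nat \<Rightarrow> nat) \<Rightarrow> (nat \<Rightarrow> int) \<Rightarrow> nat \<Rightarrow> bool" where
  "critical G \<tau> f v \<longleftrightarrow> f v = int (outdeg G (tail_set G \<tau> f v) v) - 1"

definition weak_identical ::
    "'e multigraph \<Rightarrow> (nat \<Rightarrow> nat) \<Rightarrow> nat \<Rightarrow> (nat \<Rightarrow> int) \<Rightarrow> (nat \<Rightarrow> int) set" where
  "weak_identical G \<tau> v f =
     {g \<in> parking_functions G.
        (\<forall>j\<in>{1..<Ord_inv G \<tau> f v}. Rea G \<tau> g j = Rea G \<tau> f j \<and> Ord G \<tau> g j = Ord G \<tau> f j) \<and>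
        g v \<ge> f v \<and>
        (\<forall>w\<in>tail_set G \<tau> f v. \<tau> w < \<tau> v \<longrightarrow> g w \<ge> int (outdeg G (tail_set G \<tau> f v) w))}"

definition strong_identical ::
    "'e multigraph \<Rightarrow> (nat \<Rightarrow> nat) \<Rightarrow> nat \<Rightarrow> (nat \<Rightarrow> int) \<Rightarrow> (nat \<Rightarrow> int) set" where
  "strong_identical G \<tau> v f =
     {g \<in> weak_identical G \<tau> v f. Ord G \<tau> g (Ord_inv G \<tau> f v) = v}"

definition bridge_vertices ::
    "'e multigraph \<Rightarrow> (nat \<Rightarrow> nat) \<Rightarrow> (nat \<Rightarrow> int) \<Rightarrow> nat set" where
  "bridge_vertices G \<tau> f =
     {v \<in> verts G - {0}. critical G \<tau> f v \<and>
        card (weak_identical G \<tau> v f) = card (strong_identical G \<tau> v f)}"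

definition bridge_count :: "'e multigraph \<Rightarrow> (nat \<Rightarrow> nat) \<Rightarrow> (nat \<Rightarrow> int) \<Rightarrow> nat" where
  "bridge_count G \<tau> f = card (bridge_vertices G \<tau> f)"

definition pf_weight :: "'e multigraph \<Rightarrow> (nat \<Rightarrow> int) \<Rightarrow> int" where
  "pf_weight G f = int (card (edges G)) - int (card (verts G)) - (\<Sum>i\<in>verts G. f i)"

end

theory Submission
  imports Defs
begin

text \<open>
  Deletion and contraction of an edge \<open>e\<close> joining 0 to its neighbour \<open>v\<close> of smallest rank. The parking
  functions with \<open>f v \<ge> 1\<close> correspond to those of \<open>G - e\<close> by subtracting 1 at \<open>v\<close>, and those with
  \<open>f v = 0\<close> correspond to those of \<open>G / e\<close> by forgetting \<open>v\<close>. Both correspondences preserve the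
  weight. After the root, the procedure always moves the vertex of smallest rank among the
  \<open>w \<notin> P\<close> with \<open>f w < outdeg (V - P) w\<close>, so both also preserve the order and the bridge vertices, except
  that in the second case \<open>v\<close> comes right after the root and is lost. It is a bridge vertex exactly
  if there is no parking function with \<open>f v \<ge> 1\<close>, that is, if \<open>G - e\<close> is disconnected.
\<close>

section \<open>The order of a parking function\<close>

text \<open>Whether a vertex is a bridge vertex is not determined by the order of f alone: the
  definition quantifies over all parking functions that agree with f up to a position. Hence a
  bijection of parking functions that preserves the order does not suffice; the functions compared
  with f have to be carried over as well, in both directions. This is the reason for choosing the
  neighbour of smallest rank. If \<open>f v\<close> is positive, a comparison function with value 0
  at \<open>v\<close> is excluded at position 1 by the third condition of weak identity, and at
  later positions because it would have \<open>v\<close> in the common prefix. Bridge vertices are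
  tracked by their position in the order rather than by their name, so that contraction becomes a
  shift by one. When G - e is disconnected, its sum over parking functions is empty, and the
  additional bridge vertex supplies the factor x in T_G = x T_{G/e}.\<close>

definition eligible :: "'e multigraph \<Rightarrow> (nat \<Rightarrow> int) \<Rightarrow> nat set \<Rightarrow> nat set" where
  "eligible G f P = {w \<in> verts G - P. f w < int (outdeg G (verts G - P) w)}"

definition next_vertex :: "'e multigraph \<Rightarrow> (nat \<Rightarrow> nat) \<Rightarrow> (nat \<Rightarrow> int) \<Rightarrow> nat set \<Rightarrow> nat" where
  "next_vertex G \<tau> f P = arg_min_on \<tau> (eligible G f P)"

text \<open>The current value of a vertex that has not yet entered Q is f minus its number of edges
  to P, so the next vertex depends only on f and the set P. A plain list therefore replaces the
  state of the procedure.\<close>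

primrec ord_prefix :: "'e multigraph \<Rightarrow> (nat \<Rightarrow> nat) \<Rightarrow> (nat \<Rightarrow> int) \<Rightarrow> nat \<Rightarrow> nat list" where
  "ord_prefix G \<tau> f 0 = []"
| "ord_prefix G \<tau> f (Suc k) = ord_prefix G \<tau> f k @ [next_vertex G \<tau> f (set (ord_prefix G \<tau> f k))]"

lemma length_ord_prefix [simp]: "length (ord_prefix G \<tau> f k) = k"
  by (induction k) auto

lemma take_ord_prefix: "i \<le> k \<Longrightarrow> take i (ord_prefix G \<tau> f k) = ord_prefix G \<tau> f i"
  by (induction k) (auto simp: le_Suc_eq)

lemma nth_ord_prefix:
  assumes "i < k"
  shows "ord_prefix G \<tau> f k ! i = next_vertex G \<tau> f (set (ord_prefix G \<tau> f i))"
proof -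
  have "ord_prefix G \<tau> f k ! i = take (Suc i) (ord_prefix G \<tau> f k) ! i" by simp
  also have "\<dots> = ord_prefix G \<tau> f (Suc i) ! i" using assms by (subst take_ord_prefix) auto
  finally show ?thesis by (simp add: nth_append)
qed

lemma set_ord_prefix_mono: "i \<le> k \<Longrightarrow> set (ord_prefix G \<tau> f i) \<subseteq> set (ord_prefix G \<tau> f k)"
  by (metis set_take_subset take_ord_prefix)

section \<open>Basic properties of parking functions and outdegrees\<close>

lemma parking_root: "f \<in> parking_functions G \<Longrightarrow> f 0 = - 1"
  by (simp add: parking_functions_def)

lemma parking_nonneg:
  assumes "f \<in> parking_functions G" "v \<in> verts G" "v \<noteq> 0"
  shows "0 \<le> f v"
proof -
  have "{v} \<subseteq> verts G - {0} \<and> {v} \<noteq> {} \<longrightarrow>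
      (\<exists>u\<in>{v}. 0 \<le> f u \<and> f u < int (outdeg G {v} u))"
    using assms(1) unfolding parking_functions_def by blast
  then show ?thesis using assms by simp
qed

lemma parkingD:
  assumes "f \<in> parking_functions G" "I \<subseteq> verts G - {0}" "I \<noteq> {}"
  shows "\<exists>v\<in>I. 0 \<le> f v \<and> f v < int (outdeg G I v)"
  using assms unfolding parking_functions_def by blast

text \<open>Once values off the root are nonnegative, the codomain condition and the lower bound in
  the parking condition are automatic, so constructions only have to check the upper bound.\<close>

lemma parkingI:
  assumes "f \<in> extensional (verts G)" "0 \<in> verts G" "f 0 = - 1"
    and "\<And>v. v \<in> verts G \<Longrightarrow> v \<noteq> 0 \<Longrightarrow> 0 \<le> f v"
    and "\<And>I. I \<subseteq> verts G - {0} \<Longrightarrow> I \<noteq> {} \<Longrightarrow> \<exists>v\<in>I. f v < int (outdeg G I v)"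
  shows "f \<in> parking_functions G"
proof -
  have "f v \<in> insert (- 1) \<nat>" if "v \<in> verts G" for v
    using assms(3) assms(4)[OF that] by (cases "v = 0") (auto simp: Nats_altdef1)
  moreover have "\<exists>v\<in>I. 0 \<le> f v \<and> f v < int (outdeg G I v)" if "I \<subseteq> verts G - {0}" "I \<noteq> {}" for I
    using assms(4) assms(5)[OF that] that by blast
  ultimately show ?thesis using assms(1,3) unfolding parking_functions_def
    by (auto simp: PiE_def)
qed

lemma parking_extensional: "f \<in> parking_functions G \<Longrightarrow> f \<in> extensional (verts G)"
  by (simp add: parking_functions_def PiE_def)

text \<open>Moving \<open>v\<close> to the other side turns exactly the edges between
  \<open>w\<close> and \<open>v\<close> into outgoing ones. This matches the amount that the
  procedure subtracts.\<close>

lemma outdeg_insert: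
  assumes "finite_multigraph G" "v \<notin> P" "v \<in> verts G" "w \<in> verts G - P" "w \<noteq> v"
  shows "outdeg G (verts G - insert v P) w = outdeg G (verts G - P) w + mu G w v"
proof -
  have fin: "finite (edges G)" using assms(1) by (simp add: finite_multigraph_def)
  have "{e \<in> edges G. \<exists>u. u \<notin> verts G - insert v P \<and> ends G e = Upair u w} =
    {e \<in> edges G. \<exists>u. u \<notin> verts G - P \<and> ends G e = Upair u w} \<union>
    {e \<in> edges G. ends G e = Upair w v}"
    using assms by (auto simp: Upair_inject)
  moreover have "{e \<in> edges G. \<exists>u. u \<notin> verts G - P \<and> ends G e = Upair u w} \<inter>
    {e \<in> edges G. ends G e = Upair w v} = {}"
    using assms by (auto simp: Upair_inject)
  ultimately show ?thesis unfolding outdeg_def mu_def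
    using fin by (simp add: card_Un_disjoint)
qed

lemma outdeg_verts:
  assumes "finite_multigraph G"
  shows "outdeg G (verts G) w = 0"
proof -
  have "{e \<in> edges G. \<exists>u. u \<notin> verts G \<and> ends G e = Upair u w} = {}"
    using assms by (force simp: finite_multigraph_def)
  then show ?thesis unfolding outdeg_def by (metis card.empty)
qed

lemma eligible_empty:
  assumes "finite_multigraph G" "0 \<in> verts G" "f \<in> parking_functions G"
  shows "eligible G f {} = {0}"
  using assms parking_root[of f G] parking_nonneg[of f G]
  by (fastforce simp: eligible_def outdeg_verts)

text \<open>The parking condition for \<open>I = verts G - P\<close> yields an eligible vertex. It
  only speaks about sets without the root, so the empty P is treated separately.\<close>

lemma eligible_nonempty:
  assumes G: "finite_multigraph G" "0 \<in> verts G" "f \<in> parking_functions G"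
    and "0 \<in> P \<or> P = {}" "\<not> verts G \<subseteq> P"
  shows "eligible G f P \<noteq> {}"
proof (cases "P = {}")
  case True
  then show ?thesis using eligible_empty[OF G] by simp
next
  case False
  then show ?thesis using parkingD[OF G(3), of "verts G - P"] assms by (auto simp: eligible_def)
qed

lemma arg_min_on_in: "finite Q \<Longrightarrow> Q \<noteq> {} \<Longrightarrow> arg_min_on (\<tau> :: nat \<Rightarrow> nat) Q \<in> Q"
  by (rule arg_min_if_finite(1))

text \<open>\<open>arg_min_on\<close> is a choice; injectivity of the ranking makes the minimiser
  unique.\<close>

lemma arg_min_on_eq:
  assumes "inj (\<tau> :: nat \<Rightarrow> nat)" "finite Q" "v \<in> Q" "\<And>w. w \<in> Q \<Longrightarrow> \<tau> v \<le> \<tau> w"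
  shows "arg_min_on \<tau> Q = v"
proof -
  have "arg_min_on \<tau> Q \<in> Q" using assms arg_min_on_in by blast
  moreover have "\<tau> (arg_min_on \<tau> Q) \<le> \<tau> v" using assms by (intro arg_min_least) auto
  ultimately show ?thesis using assms(1,4) by (metis injD le_antisym)
qed

lemma arg_min_on_singleton [simp]: "arg_min_on (\<tau> :: nat \<Rightarrow> nat) {v} = v"
  using arg_min_on_in[of "{v}" \<tau>] by simp

text \<open>The vertex set is an arbitrary finite set containing 0, since contraction leaves gaps in
  the labels; connectedness is left out, since deletion may destroy it.\<close>

locale rooted_multigraph =
  fixes G :: "'e multigraph"
  assumes fin: "finite_multigraph G"
    and root: "0 \<in> verts G"
begin

lemma finite_verts: "finite (verts G)" and finite_edges: "finite (edges G)"
  using fin by (auto simp: finite_multigraph_def)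

lemma finite_eligible: "finite (eligible G f P)"
  unfolding eligible_def using finite_verts by simp

lemma next_vertex_root:
  assumes "f \<in> parking_functions G"
  shows "next_vertex G \<tau> f {} = 0"
  using eligible_empty[OF fin root assms] by (simp add: next_vertex_def)

lemma root_in_ord_prefix:
  assumes "f \<in> parking_functions G" "0 < k"
  shows "0 \<in> set (ord_prefix G \<tau> f k)"
  using assms(2) set_ord_prefix_mono[of 1 k G \<tau> f] next_vertex_root[OF assms(1)] by simp

text \<open>Fewer than |V| distinct vertices cannot exhaust V, so some vertex is still eligible, and
  eligible vertices lie outside the prefix.\<close>

lemma ord_prefix_subset:
  assumes "f \<in> parking_functions G" "k \<le> card (verts G)"
  shows "set (ord_prefix G \<tau> f k) \<subseteq> verts G \<and> distinct (ord_prefix G \<tau> f k)"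
  using assms(2)
proof (induction k)
  case (Suc k)
  let ?P = "set (ord_prefix G \<tau> f k)"
  have IH: "?P \<subseteq> verts G" "distinct (ord_prefix G \<tau> f k)" using Suc by auto
  then have "card ?P = k" by (simp add: distinct_card)
  then have "\<not> verts G \<subseteq> ?P" using Suc.prems
    by (metis List.finite_set card_mono not_less_eq_eq)
  moreover have "0 \<in> ?P \<or> ?P = {}" using root_in_ord_prefix[OF assms(1), of k] by (cases k) auto
  ultimately have "eligible G f ?P \<noteq> {}" using eligible_nonempty[OF fin root assms(1)] by simp
  then have "next_vertex G \<tau> f ?P \<in> eligible G f ?P"
    unfolding next_vertex_def using arg_min_on_in finite_eligible by blast
  then show ?case using IH by (auto simp: eligible_def)
qed simp

lemma next_vertex_eligible:
  fixes \<tau> :: "nat \<Rightarrow> nat"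
  assumes "f \<in> parking_functions G" "k < card (verts G)"
  defines "P \<equiv> set (ord_prefix G \<tau> f k)"
  shows "next_vertex G \<tau> f P \<in> eligible G f P" "eligible G f P \<noteq> {}"
proof -
  have "set (ord_prefix G \<tau> f k) \<subseteq> verts G \<and> distinct (ord_prefix G \<tau> f k)"
    using ord_prefix_subset[of f k] assms by simp
  then have "card P = k" unfolding P_def by (simp add: distinct_card)
  then have "\<not> verts G \<subseteq> P" using assms(2)
    by (metis P_def List.finite_set card_mono not_le)
  moreover have "0 \<in> P \<or> P = {}"
    unfolding P_def using root_in_ord_prefix[OF assms(1), of k] by (cases k) auto
  ultimately show "eligible G f P \<noteq> {}" using eligible_nonempty[OF fin root assms(1)] by simp
  then show "next_vertex G \<tau> f P \<in> eligible G f P"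
    unfolding next_vertex_def using arg_min_on_in finite_eligible by blast
qed

text \<open>
  The set \<open>Q\<close> of the procedure consists of the eligible vertices. This includes the initial state,
  because the outdegree with respect to all vertices is 0 and only \<open>f 0\<close> is negative.
\<close>

lemma ord_step_invariant:
  assumes f: "f \<in> parking_functions G" and "k \<le> card (verts G)"
  shows "\<exists>val. (ord_step G \<tau> ^^ k) (f, [], {0}) =
      (val, ord_prefix G \<tau> f k, eligible G f (set (ord_prefix G \<tau> f k))) \<and>
    (\<forall>w \<in> verts G - set (ord_prefix G \<tau> f k) - eligible G f (set (ord_prefix G \<tau> f k)).
      val w = f w - int (outdeg G (verts G - set (ord_prefix G \<tau> f k)) w))"
  using assms(2)
proof (induction k)
  case 0
  then show ?case using eligible_empty[OF fin root f] by (simp add: outdeg_verts[OF fin])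
next
  case (Suc k)
  let ?L = "ord_prefix G \<tau> f k"
  let ?P = "set ?L"
  let ?Q = "eligible G f ?P"
  let ?v = "next_vertex G \<tau> f ?P"
  obtain val where st: "(ord_step G \<tau> ^^ k) (f, [], {0}) = (val, ?L, ?Q)"
    and val: "\<And>w. w \<in> verts G - ?P - ?Q \<Longrightarrow> val w = f w - int (outdeg G (verts G - ?P) w)"
    using Suc by auto
  have v: "?v \<in> ?Q" using next_vertex_eligible[OF f, of k] Suc.prems by auto
  then have vV: "?v \<in> verts G" "?v \<notin> ?P" by (auto simp: eligible_def)
  have od: "outdeg G (verts G - insert ?v ?P) w = outdeg G (verts G - ?P) w + mu G w ?v"
    if "w \<in> verts G - ?P" "w \<noteq> ?v" for w
    using outdeg_insert[OF fin vV(2,1) that] .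
  let ?U = "verts G - (?P \<union> ?Q)"
  let ?N = "{w \<in> ?U. 0 \<le> val w \<and> val w < int (mu G w ?v)}"
  let ?val = "\<lambda>w. if w \<in> ?U - ?N then val w - int (mu G w ?v) else val w"
  have step: "(ord_step G \<tau> ^^ Suc k) (f, [], {0}) = (?val, ?L @ [?v], (?Q - {?v}) \<union> ?N)"
  proof -
    have "ord_step G \<tau> (val, ?L, ?Q) = (?val, ?L @ [?v], (?Q - {?v}) \<union> ?N)"
      unfolding ord_step_def next_vertex_def Let_def prod.case ..
    then show ?thesis using st by simp
  qed
  \<comment> \<open>Outdegrees only grow, so the old members of Q other than \<open>?v\<close> stay
    eligible. A new one enters exactly if its value, already reduced by the edges to P, is below its
    number of edges to \<open>?v\<close>.\<close>
  have elig: "eligible G f (insert ?v ?P) = (?Q - {?v}) \<union> ?N"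
  proof (intro equalityI subsetI)
    fix w assume "w \<in> eligible G f (insert ?v ?P)"
    then have w: "w \<in> verts G - ?P" "w \<noteq> ?v"
      "f w < int (outdeg G (verts G - ?P) w + mu G w ?v)"
      using od by (auto simp: eligible_def)
    show "w \<in> (?Q - {?v}) \<union> ?N"
    proof (cases "w \<in> ?Q")
      case False
      \<comment> \<open>A vertex outside Q satisfies \<open>f w \<ge> outdeg\<close>, so the test
        \<open>0 \<le> val w\<close> of the procedure always succeeds.\<close>
      then have "val w = f w - int (outdeg G (verts G - ?P) w)" "0 \<le> val w"
        using w val by (auto simp: eligible_def)
      then show ?thesis using w False by auto
    qed (use w in auto)
  next
    fix w assume w: "w \<in> (?Q - {?v}) \<union> ?N"
    then have w1: "w \<in> verts G - ?P" "w \<noteq> ?v" using v by (auto simp: eligible_def)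
    have "f w < int (outdeg G (verts G - ?P) w + mu G w ?v)"
    proof (cases "w \<in> ?Q")
      case True
      then show ?thesis by (auto simp: eligible_def)
    next
      case False
      then show ?thesis using w val[of w] by auto
    qed
    then show "w \<in> eligible G f (insert ?v ?P)" using w1 od by (auto simp: eligible_def)
  qed
  have nval: "?val w = f w - int (outdeg G (verts G - insert ?v ?P) w)"
    if "w \<in> verts G - insert ?v ?P - eligible G f (insert ?v ?P)" for w
  proof -
    have w: "w \<in> verts G - ?P" "w \<noteq> ?v" "w \<notin> ?Q" "w \<notin> ?N" using that elig by auto
    then have "w \<in> ?U - ?N" by blast
    then have "?val w = val w - int (mu G w ?v)" by (rule if_P)
    then show ?thesis using w od[OF w(1,2)] val[of w] by simp
  qed
  have set': "set (ord_prefix G \<tau> f (Suc k)) = insert ?v ?P" by simp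
  show ?case
    unfolding set' using step nval unfolding elig[symmetric] ord_prefix.simps by blast
qed

lemma Ord_eq:
  assumes "f \<in> parking_functions G" "i < card (verts G)"
  shows "Ord G \<tau> f i = next_vertex G \<tau> f (set (ord_prefix G \<tau> f i))"
  using ord_step_invariant[OF assms(1), of "card (verts G)" \<tau>] assms(2)
  unfolding Ord_def by (auto simp: nth_ord_prefix)

lemma Ord_eq_nth:
  assumes "f \<in> parking_functions G" "i < k" "k \<le> card (verts G)"
  shows "Ord G \<tau> f i = ord_prefix G \<tau> f k ! i"
  using Ord_eq[of f i \<tau>] assms by (simp add: nth_ord_prefix)

lemma Ord_image:
  assumes "f \<in> parking_functions G" "k \<le> card (verts G)"
  shows "Ord G \<tau> f ` {..<k} = set (ord_prefix G \<tau> f k)"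
  using assms Ord_eq_nth[OF assms(1)] by (force simp: in_set_conv_nth)

lemma set_ord_prefix_full:
  assumes "f \<in> parking_functions G"
  shows "set (ord_prefix G \<tau> f (card (verts G))) = verts G"
  using ord_prefix_subset[OF assms, of "card (verts G)" \<tau>] finite_verts
  by (intro card_subset_eq) (auto simp: distinct_card)

lemma bij_betw_Ord:
  assumes "f \<in> parking_functions G"
  shows "bij_betw (Ord G \<tau> f) {..<card (verts G)} (verts G)"
proof -
  have "Ord G \<tau> f ` {..<card (verts G)} = verts G"
    using Ord_image[OF assms order_refl] set_ord_prefix_full[OF assms] by simp
  then show ?thesis unfolding bij_betw_def by (auto intro: eq_card_imp_inj_on)
qed

lemma Ord_inv_Ord:
  assumes "f \<in> parking_functions G" "i < card (verts G)"
  shows "Ord_inv G \<tau> f (Ord G \<tau> f i) = i"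
  using bij_betw_Ord[OF assms(1), of \<tau>] assms(2) unfolding Ord_inv_def bij_betw_def
  by (simp add: the_inv_into_f_f)

text \<open>This turns the sets I_v into complements of prefixes; injectivity of the order lets the
  image commute with set difference.\<close>

lemma tail_set_Ord:
  assumes "f \<in> parking_functions G" "i < card (verts G)"
  shows "tail_set G \<tau> f (Ord G \<tau> f i) = verts G - set (ord_prefix G \<tau> f i)"
proof -
  have inj: "inj_on (Ord G \<tau> f) {..<card (verts G)}"
    and im: "Ord G \<tau> f ` {..<card (verts G)} = verts G"
    using bij_betw_Ord[OF assms(1), of \<tau>] by (auto simp: bij_betw_def)
  have "{i..<card (verts G)} = {..<card (verts G)} - {..<i}" by auto
  moreover have "Ord G \<tau> f ` ({..<card (verts G)} - {..<i}) =
      Ord G \<tau> f ` {..<card (verts G)} - Ord G \<tau> f ` {..<i}"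
    using assms(2) by (intro inj_on_image_set_diff[OF inj]) auto
  ultimately show ?thesis unfolding tail_set_def Ord_inv_Ord[OF assms]
    using im Ord_image[OF assms(1), of i \<tau>] assms(2) by simp
qed

text \<open>The parking condition on singletons bounds every value by an outdegree, hence by |E|.
  Finiteness is what lets equal cardinalities of nested sets be read as equality.\<close>

lemma finite_parking_functions: "finite (parking_functions G)"
proof (rule finite_subset)
  show "parking_functions G \<subseteq> verts G \<rightarrow>\<^sub>E {- 1 .. int (card (edges G))}"
  proof
    fix f assume f: "f \<in> parking_functions G"
    have "f v \<in> {- 1 .. int (card (edges G))}" if v: "v \<in> verts G" for v
    proof (cases "v = 0")
      case True
      then show ?thesis using parking_root[OF f] by simp
    next
      case False
      have "outdeg G {v} v \<le> card (edges G)"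
        unfolding outdeg_def using finite_edges by (intro card_mono) auto
      then show ?thesis using parkingD[OF f, of "{v}"] v False by auto
    qed
    then show "f \<in> verts G \<rightarrow>\<^sub>E {- 1 .. int (card (edges G))}"
      using parking_extensional[OF f] by (auto simp: PiE_def)
  qed
  show "finite (verts G \<rightarrow>\<^sub>E {- 1 .. int (card (edges G))})"
    using finite_verts by (simp add: finite_PiE)
qed

end

text \<open>
  Weak identity and bridge vertices in terms of the position \<open>i\<close> of the vertex in the order.
  The cardinality condition says that every weakly identical function is strongly identical.
\<close>

definition weakly_agrees ::
    "'e multigraph \<Rightarrow> (nat \<Rightarrow> nat) \<Rightarrow> (nat \<Rightarrow> int) \<Rightarrow> nat \<Rightarrow> (nat \<Rightarrow> int) \<Rightarrow> bool" where
  "weakly_agrees G \<tau> f i g \<longleftrightarrow> (let P = set (ord_prefix G \<tau> f i); v = next_vertex G \<tau> f P in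
     g \<in> parking_functions G \<and> ord_prefix G \<tau> g i = ord_prefix G \<tau> f i \<and> (\<forall>u\<in>P. g u = f u) \<and>
     g v \<ge> f v \<and> (\<forall>w \<in> verts G - P. \<tau> w < \<tau> v \<longrightarrow> g w \<ge> int (outdeg G (verts G - P) w)))"

definition bridge_index ::
    "'e multigraph \<Rightarrow> (nat \<Rightarrow> nat) \<Rightarrow> (nat \<Rightarrow> int) \<Rightarrow> nat \<Rightarrow> bool" where
  "bridge_index G \<tau> f i \<longleftrightarrow> (let P = set (ord_prefix G \<tau> f i); v = next_vertex G \<tau> f P in
     f v = int (outdeg G (verts G - P) v) - 1 \<and>
     (\<forall>g. weakly_agrees G \<tau> f i g \<longrightarrow> next_vertex G \<tau> g P = v))"

context rooted_multigraph
begin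

text \<open>Once the two orders agree at a position, equality of \<open>Rea\<close> there compares
  the two functions at the same vertex. The positionwise condition thus amounts to equal prefixes
  and equal values on them.\<close>

lemma weak_identical_Ord:
  assumes f: "f \<in> parking_functions G" and i: "0 < i" "i < card (verts G)"
  shows "weak_identical G \<tau> (Ord G \<tau> f i) f = {g. weakly_agrees G \<tau> f i g}"
proof -
  have "(\<forall>j\<in>{1..<i}. Rea G \<tau> g j = Rea G \<tau> f j \<and> Ord G \<tau> g j = Ord G \<tau> f j) \<longleftrightarrow>
      ord_prefix G \<tau> g i = ord_prefix G \<tau> f i \<and> (\<forall>u\<in>set (ord_prefix G \<tau> f i). g u = f u)"
    (is "?L \<longleftrightarrow> ?R") if g: "g \<in> parking_functions G" for g
  proof -
    have nth: "ord_prefix G \<tau> g i ! j = Ord G \<tau> g j" "ord_prefix G \<tau> f i ! j = Ord G \<tau> f j"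
      if "j < i" for j using Ord_eq_nth[OF f that, of \<tau>] Ord_eq_nth[OF g that, of \<tau>] i by auto
    have mem: "Ord G \<tau> f j \<in> set (ord_prefix G \<tau> f i)" if "j < i" for j
      using nth_mem[of j "ord_prefix G \<tau> f i"] nth(2)[OF that] that by simp
    have 0: "Ord G \<tau> g 0 = 0" "Ord G \<tau> f 0 = 0"
      using Ord_eq[OF f, of 0] Ord_eq[OF g, of 0] next_vertex_root f g i by auto
    have "?L \<longleftrightarrow> (\<forall>j\<in>{1..<i}. g (Ord G \<tau> f j) = f (Ord G \<tau> f j) \<and> Ord G \<tau> g j = Ord G \<tau> f j)"
      unfolding Rea_def by auto
    \<comment> \<open>Position 0 can be added freely: both orders start with the root, where every
      parking function is -1.\<close>
    also have "\<dots> \<longleftrightarrow> (\<forall>j<i. g (Ord G \<tau> f j) = f (Ord G \<tau> f j) \<and> Ord G \<tau> g j = Ord G \<tau> f j)"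
      using 0 parking_root[OF f] parking_root[OF g]
      by (metis One_nat_def Suc_leI atLeastLessThan_iff neq0_conv)
    also have "\<dots> \<longleftrightarrow> ?R"
      using nth mem by (auto simp: list_eq_iff_nth_eq) (metis in_set_conv_nth length_ord_prefix)
    finally show ?thesis .
  qed
  then show ?thesis
    using tail_set_Ord[OF f i(2), of \<tau>] Ord_inv_Ord[OF f i(2), of \<tau>] Ord_eq[OF f i(2), of \<tau>]
    unfolding weak_identical_def weakly_agrees_def Let_def by auto
qed

lemma Ord_in_bridge_vertices:
  assumes f: "f \<in> parking_functions G" and i: "0 < i" "i < card (verts G)"
  shows "Ord G \<tau> f i \<in> bridge_vertices G \<tau> f \<longleftrightarrow> bridge_index G \<tau> f i"
proof -
  let ?v = "Ord G \<tau> f i"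
  let ?P = "set (ord_prefix G \<tau> f i)"
  have v: "?v = next_vertex G \<tau> f ?P" using Ord_eq[OF f i(2)] .
  have "?v \<in> eligible G f ?P" using next_vertex_eligible(1)[OF f i(2)] v by simp
  then have "?v \<in> verts G" "?v \<notin> ?P" by (auto simp: eligible_def)
  then have vV: "?v \<in> verts G - {0}"
    using root_in_ord_prefix[OF f i(1), of \<tau>] by (metis DiffI singletonD)
  let ?W = "weak_identical G \<tau> ?v f"
  let ?S = "strong_identical G \<tau> ?v f"
  have "finite ?W" "?S \<subseteq> ?W"
    using finite_parking_functions by (auto simp: weak_identical_def strong_identical_def)
  then have "card ?W = card ?S \<longleftrightarrow> ?S = ?W" by (metis card_subset_eq)
  also have "\<dots> \<longleftrightarrow> (\<forall>g\<in>?W. Ord G \<tau> g i = ?v)"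
    unfolding strong_identical_def Ord_inv_Ord[OF f i(2)] by auto
  also have "\<dots> \<longleftrightarrow> (\<forall>g. weakly_agrees G \<tau> f i g \<longrightarrow> Ord G \<tau> g i = ?v)"
    unfolding weak_identical_Ord[OF f i] by auto
  also have "\<dots> \<longleftrightarrow> (\<forall>g. weakly_agrees G \<tau> f i g \<longrightarrow> next_vertex G \<tau> g ?P = ?v)"
    using Ord_eq[OF _ i(2), of _ \<tau>] by (auto simp: weakly_agrees_def Let_def)
  finally show ?thesis
    unfolding bridge_vertices_def bridge_index_def critical_def Let_def
    using vV tail_set_Ord[OF f i(2), of \<tau>] v by auto
qed

text \<open>Counting positions makes graphs with different vertex sets comparable. Position 0 is
  omitted because it holds the root.\<close>

lemma bridge_count_eq:
  assumes f: "f \<in> parking_functions G"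
  shows "bridge_count G \<tau> f = card {i \<in> {1..<card (verts G)}. bridge_index G \<tau> f i}"
proof -
  let ?I = "{i \<in> {1..<card (verts G)}. bridge_index G \<tau> f i}"
  have bij: "inj_on (Ord G \<tau> f) {..<card (verts G)}"
    "Ord G \<tau> f ` {..<card (verts G)} = verts G"
    using bij_betw_Ord[OF f, of \<tau>] by (auto simp: bij_betw_def)
  have pos: "0 < card (verts G)" using root finite_verts by (auto simp: card_gt_0_iff)
  have "Ord G \<tau> f 0 = 0" using Ord_eq[OF f pos] next_vertex_root[OF f] by simp
  have "bridge_vertices G \<tau> f = Ord G \<tau> f ` ?I"
  proof (intro equalityI subsetI)
    fix v assume v: "v \<in> bridge_vertices G \<tau> f"
    then have "v \<in> verts G" "v \<noteq> 0" by (auto simp: bridge_vertices_def)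
    then obtain i where i: "i < card (verts G)" "v = Ord G \<tau> f i" using bij(2) by blast
    then have "0 < i" using \<open>v \<noteq> 0\<close> \<open>Ord G \<tau> f 0 = 0\<close> by (cases i) auto
    then show "v \<in> Ord G \<tau> f ` ?I" using i v Ord_in_bridge_vertices[OF f] by auto
  next
    fix v assume "v \<in> Ord G \<tau> f ` ?I"
    then show "v \<in> bridge_vertices G \<tau> f" using Ord_in_bridge_vertices[OF f] by auto
  qed
  moreover have "inj_on (Ord G \<tau> f) ?I" using bij(1) by (rule inj_on_subset) auto
  ultimately show ?thesis unfolding bridge_count_def by (simp add: card_image)
qed

end

section \<open>Deletion and contraction for the Tutte polynomial\<close>

definition delete_edge :: "'e multigraph \<Rightarrow> 'e \<Rightarrow> 'e multigraph" where
  "delete_edge G e = \<lparr>verts = verts G, edges = edges G - {e}, ends = ends G\<rparr>"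

definition merge_root :: "nat \<Rightarrow> nat \<Rightarrow> nat" where
  "merge_root v u = (if u = v then 0 else u)"

text \<open>\<open>v\<close> is absorbed into 0, so the root keeps its label. Only \<open>e\<close>
  disappears; edges parallel to it survive as loops at 0.\<close>

definition contract_edge :: "'e multigraph \<Rightarrow> 'e \<Rightarrow> nat \<Rightarrow> 'e multigraph" where
  "contract_edge G e v = \<lparr>verts = verts G - {v}, edges = edges G - {e},
     ends = (\<lambda>d. map_uprod (merge_root v) (ends G d))\<rparr>"

lemma delete_edge_simps [simp]:
  "verts (delete_edge G e) = verts G" "edges (delete_edge G e) = edges G - {e}"
  "ends (delete_edge G e) = ends G"
  by (simp_all add: delete_edge_def)

lemma contract_edge_simps [simp]:
  "verts (contract_edge G e v) = verts G - {v}" "edges (contract_edge G e v) = edges G - {e}"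
  "ends (contract_edge G e v) d = map_uprod (merge_root v) (ends G d)"
  by (simp_all add: contract_edge_def)

section \<open>Connected components and rank under insertion and contraction of an edge\<close>

lemma sym_adj_rel: "sym (adj_rel G A)"
proof (rule symI)
  fix x y assume "(x, y) \<in> adj_rel G A"
  then obtain e where "e \<in> A" "ends G e = Upair y x" by (auto simp: adj_rel_def Upair_inject)
  then show "(y, x) \<in> adj_rel G A" by (auto simp: adj_rel_def)
qed

lemma equiv_conn_rel: "equiv (verts G) (conn_rel G A)"
proof (rule equivI)
  show "conn_rel G A \<subseteq> verts G \<times> verts G" by (auto simp: conn_rel_def)
  show "refl_on (verts G) (conn_rel G A)" by (auto simp: refl_on_def conn_rel_def)
  show "sym (conn_rel G A)"
    using symD[OF sym_rtrancl[OF sym_adj_rel[of G A]]] unfolding conn_rel_def by (blast intro: symI)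
  show "trans (conn_rel G A)"
    using rtrancl_trans[of _ _ "adj_rel G A"] unfolding conn_rel_def by (blast intro: transI)
qed

lemma conn_rel_delete [simp]: "conn_rel (delete_edge G e) A = conn_rel G A"
  by (simp add: conn_rel_def adj_rel_def)

lemma graphic_rank_delete [simp]: "graphic_rank (delete_edge G e) A = graphic_rank G A"
  by (simp add: graphic_rank_def)

lemma adj_rel_insert:
  assumes "ends G e = Upair a b"
  shows "adj_rel G (insert e A) = insert (a, b) (insert (b, a) (adj_rel G A))"
  using assms by (auto simp: adj_rel_def Upair_inject)

text \<open>A new edge merges the classes of its two ends and leaves all other classes
  alone.\<close>

lemma conn_rel_insert:
  assumes e: "ends G e = Upair a b" "a \<in> verts G" "b \<in> verts G"
  shows "conn_rel G (insert e A) = conn_rel G A \<union>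
    (conn_rel G A `` {a, b}) \<times> (conn_rel G A `` {a, b})"
proof -
  define S where "S = (adj_rel G A)\<^sup>*"
  have symm: "(x, y) \<in> S \<Longrightarrow> (y, x) \<in> S" for x y
    unfolding S_def by (rule symD[OF sym_rtrancl[OF sym_adj_rel]])
  have tr: "(x, y) \<in> S \<Longrightarrow> (y, z) \<in> S \<Longrightarrow> (x, z) \<in> S" for x y z
    unfolding S_def by (rule rtrancl_trans)
  \<comment> \<open>\<open>rtrancl_insert\<close> is applied twice, because an undirected edge
    contributes both ordered pairs.\<close>
  have ins: "(adj_rel G (insert e A))\<^sup>* =
      (S \<union> {(x, y). (x, b) \<in> S \<and> (a, y) \<in> S}) \<union>
      {(x, y). (x, a) \<in> S \<union> {(x, y). (x, b) \<in> S \<and> (a, y) \<in> S} \<and>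
        (b, y) \<in> S \<union> {(x, y). (x, b) \<in> S \<and> (a, y) \<in> S}}"
    unfolding adj_rel_insert[OF e(1)] rtrancl_insert S_def ..
  have "(adj_rel G (insert e A))\<^sup>* = S \<union> (S `` {a, b}) \<times> (S `` {a, b})"
  proof (intro equalityI subrelI)
    fix x y assume "(x, y) \<in> (adj_rel G (insert e A))\<^sup>*"
    then show "(x, y) \<in> S \<union> (S `` {a, b}) \<times> (S `` {a, b})"
      unfolding ins by (auto dest: symm)
  next
    fix x y assume "(x, y) \<in> S \<union> (S `` {a, b}) \<times> (S `` {a, b})"
    then consider "(x, y) \<in> S" | "(a, x) \<in> S" "(a, y) \<in> S" | "(b, x) \<in> S" "(b, y) \<in> S"
      | "(a, x) \<in> S" "(b, y) \<in> S" | "(b, x) \<in> S" "(a, y) \<in> S" by auto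
    then show "(x, y) \<in> (adj_rel G (insert e A))\<^sup>*"
      by cases (auto simp: ins dest: symm tr[OF symm])
  qed
  then show ?thesis using e(2,3) unfolding conn_rel_def S_def by auto
qed

text \<open>Taking preimages under \<open>c\<close> is a bijection from the classes of
  \<open>R'\<close> to those of \<open>R\<close>. The map \<open>c\<close> may identify vertices, as
  a contraction does.\<close>

lemma card_quotient_cong:
  assumes R: "equiv V R" and R': "equiv V' R'" and c: "c ` V = V'"
    and iff: "\<And>x y. x \<in> V \<Longrightarrow> y \<in> V \<Longrightarrow> (x, y) \<in> R \<longleftrightarrow> (c x, c y) \<in> R'"
  shows "card (V // R) = card (V' // R')"
proof -
  let ?h = "\<lambda>X'. {x \<in> V. c x \<in> X'}"
  have h: "?h (R' `` {c x}) = R `` {x}" if "x \<in> V" for x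
    using that iff[OF that] R by (auto simp: equiv_def)
  have "?h ` (V' // R') = V // R"
    using h c unfolding quotient_def by (auto simp: image_iff)
  moreover have "inj_on ?h (V' // R')"
  proof (rule inj_onI)
    fix X Y assume X: "X \<in> V' // R'" and Y: "Y \<in> V' // R'" and eq: "?h X = ?h Y"
    have "X \<subseteq> V'" "Y \<subseteq> V'" using X Y R' by (auto simp: quotient_def equiv_def)
    then show "X = Y" using eq c by blast
  qed
  ultimately show ?thesis by (metis card_image)
qed

text \<open>These bounds keep the natural-number subtraction in \<open>graphic_rank\<close> under
  control.\<close>

lemma card_quotient_conn_rel:
  assumes "finite (verts G)" "verts G \<noteq> {}"
  shows "0 < card (verts G // conn_rel G A)" "card (verts G // conn_rel G A) \<le> card (verts G)"
proof -
  have q: "verts G // conn_rel G A = (\<lambda>x. conn_rel G A `` {x}) ` verts G"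
    by (auto simp: quotient_def)
  show "0 < card (verts G // conn_rel G A)" using assms by (simp add: q card_gt_0_iff)
  show "card (verts G // conn_rel G A) \<le> card (verts G)"
    unfolding q using assms(1) by (rule card_image_le)
qed

text \<open>A walk using \<open>e\<close> projects to the contraction, where its steps along
  \<open>e\<close> collapse. Conversely a walk lifts, because each vertex is joined to its image
  under \<open>merge_root v\<close> by \<open>e\<close> or equals it.\<close>

lemma conn_rel_contract:
  assumes e: "ends G e = Upair 0 v" "0 \<in> verts G" "v \<in> verts G" "v \<noteq> 0"
    and xy: "x \<in> verts G" "y \<in> verts G"
  shows "(merge_root v x, merge_root v y) \<in> conn_rel (contract_edge G e v) A \<longleftrightarrow>
    (x, y) \<in> conn_rel G (insert e A)"
proof -
  let ?G' = "contract_edge G e v"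
  let ?c = "merge_root v"
  let ?R = "(adj_rel G (insert e A))\<^sup>*"
  let ?R' = "(adj_rel ?G' A)\<^sup>*"
  have in': "?c x \<in> verts ?G'" "?c y \<in> verts ?G'" using e xy by (auto simp: merge_root_def)
  have symm: "(x, y) \<in> ?R \<Longrightarrow> (y, x) \<in> ?R" for x y
    by (rule symD[OF sym_rtrancl[OF sym_adj_rel]])
  have 0: "(v, 0) \<in> ?R" by (rule r_into_rtrancl) (simp add: adj_rel_insert[OF e(1)])
  have c: "(u, ?c u) \<in> ?R" for u using 0 by (auto simp: merge_root_def)
  have fwd: "(?c x, ?c y) \<in> ?R'" if "(x, y) \<in> ?R" for x y
    using that
  proof (induction rule: rtrancl_induct)
    case (step y z)
    then have "(y, z) = (0, v) \<or> (y, z) = (v, 0) \<or> (y, z) \<in> adj_rel G A"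
      by (auto simp: adj_rel_insert[OF e(1)])
    moreover have "(?c y, ?c z) \<in> adj_rel ?G' A" if "(y, z) \<in> adj_rel G A"
    proof -
      from that obtain d where "d \<in> A" "ends G d = Upair y z" by (auto simp: adj_rel_def)
      then have "d \<in> A" "ends ?G' d = Upair (?c y) (?c z)" by auto
      then show ?thesis unfolding adj_rel_def by blast
    qed
    ultimately have "?c y = ?c z \<or> (?c y, ?c z) \<in> adj_rel ?G' A"
      by (auto simp: merge_root_def)
    then show ?case using step.IH by (metis rtrancl.rtrancl_into_rtrancl)
  qed simp
  have bwd: "(x, y) \<in> ?R" if "(x, y) \<in> ?R'" for x y
    using that
  proof (induction rule: rtrancl_induct)
    case (step y z)
    then obtain d where d: "d \<in> A" "map_uprod ?c (ends G d) = Upair y z"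
      by (auto simp: adj_rel_def)
    obtain p q where pq: "ends G d = Upair p q" by (metis uprod_exhaust)
    then have "(p, q) \<in> adj_rel G (insert e A)" using d by (auto simp: adj_rel_def)
    then have "(?c p, ?c q) \<in> ?R"
      using rtrancl_trans[OF symm[OF c[of p]] rtrancl_trans[OF r_into_rtrancl c[of q]]] by blast
    moreover have "(y, z) = (?c p, ?c q) \<or> (y, z) = (?c q, ?c p)"
      using d pq by (auto simp: Upair_inject)
    ultimately have "(y, z) \<in> ?R" using symm by auto
    then show ?case by (rule rtrancl_trans[OF step.IH])
  qed simp
  have "(?c x, ?c y) \<in> ?R' \<longleftrightarrow> (x, y) \<in> ?R"
    using fwd[of x y] rtrancl_trans[OF c[of x] rtrancl_trans[OF bwd symm[OF c[of y]]]] by blast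
  then show ?thesis using in' xy by (simp add: conn_rel_def)
qed

text \<open>The number of components is the same on both sides, while the contraction has one vertex
  fewer.\<close>

lemma graphic_rank_contract:
  assumes e: "ends G e = Upair 0 v" "0 \<in> verts G" "v \<in> verts G" "v \<noteq> 0"
    and fin: "finite (verts G)"
  shows "graphic_rank G (insert e A) = Suc (graphic_rank (contract_edge G e v) A)"
proof -
  let ?G' = "contract_edge G e v"
  have "merge_root v ` verts G = verts ?G'" using e by (force simp: merge_root_def)
  then have "card (verts G // conn_rel G (insert e A)) = card (verts ?G' // conn_rel ?G' A)"
    using card_quotient_cong[OF equiv_conn_rel equiv_conn_rel, of "merge_root v" G ?G' "insert e A" A]
      conn_rel_contract[OF e] by blast
  moreover have "card (verts ?G' // conn_rel ?G' A) \<le> card (verts ?G')"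
    using card_quotient_conn_rel[of ?G' A] fin e by auto
  moreover have "card (verts G) = Suc (card (verts ?G'))"
    using card_Suc_Diff1[OF fin e(3)] by simp
  ultimately show ?thesis unfolding graphic_rank_def by simp
qed

lemma graphic_rank_insert:
  assumes e: "ends G e = Upair a b" "a \<in> verts G" "b \<in> verts G"
    and ab: "(a, b) \<notin> conn_rel G A" and fin: "finite (verts G)"
  shows "graphic_rank G (insert e A) = Suc (graphic_rank G A)"
proof -
  let ?R = "conn_rel G A"
  let ?R' = "conn_rel G (insert e A)"
  let ?V = "verts G"
  let ?C = "?R `` {a, b}"
  have eq: "equiv ?V ?R" by (rule equiv_conn_rel)
  have R': "?R' = ?R \<union> ?C \<times> ?C" by (rule conn_rel_insert[OF e])
  have Cab: "?C = ?R `` {a} \<union> ?R `` {b}" by auto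
  have symR: "(x, y) \<in> ?R \<Longrightarrow> (y, x) \<in> ?R" for x y using eq by (meson equiv_def symD)
  have trR: "(x, y) \<in> ?R \<Longrightarrow> (y, z) \<in> ?R \<Longrightarrow> (x, z) \<in> ?R" for x y z
    using eq by (meson equiv_def transD)
  have "?R `` {x} \<subseteq> ?C" if "x \<in> ?C" for x using that trR by blast
  then have cls: "?R' `` {x} = (if x \<in> ?C then ?C else ?R `` {x})" for x
    unfolding R' by auto
  have aC: "a \<in> ?C" using e eq by (auto simp: equiv_def refl_on_def)
  have Ra: "?R `` {x} = ?R `` {a} \<or> ?R `` {x} = ?R `` {b}" if "x \<in> ?C" for x
    using that equiv_class_eq[OF eq, of a x] equiv_class_eq[OF eq, of b x] by auto
  have inC: "x \<in> ?C" if "x \<in> ?V" "?R `` {x} = ?R `` {a} \<or> ?R `` {x} = ?R `` {b}" for x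
    using that eq by (auto simp: equiv_def refl_on_def)
  have q: "?V // ?R = (\<lambda>x. ?R `` {x}) ` ?V" "?V // ?R' = (\<lambda>x. ?R' `` {x}) ` ?V"
    by (auto simp: quotient_def)
  have Q': "?V // ?R' = insert ?C (?V // ?R - {?R `` {a}, ?R `` {b}})" (is "_ = insert _ ?D")
  proof (intro equalityI subsetI)
    fix X assume "X \<in> ?V // ?R'"
    then obtain x where x: "x \<in> ?V" "X = ?R' `` {x}" by (auto simp: q)
    then show "X \<in> insert ?C ?D" using cls[of x] inC[of x] by (auto simp: q)
  next
    fix X assume X: "X \<in> insert ?C ?D"
    show "X \<in> ?V // ?R'"
    proof (cases "X = ?C")
      case True
      then show ?thesis using cls[of a] aC e(2) by (auto simp: q)
    next
      case False
      then obtain x where x: "x \<in> ?V" "X = ?R `` {x}" "X \<noteq> ?R `` {a}" "X \<noteq> ?R `` {b}"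
        using X by (auto simp: q)
      then have "x \<notin> ?C" using Ra[of x] by auto
      then show ?thesis using cls[of x] x by (auto simp: q)
    qed
  qed
  have finQ: "finite (?V // ?R)" using fin by (simp add: q)
  \<comment> \<open>The merged class is new: an old class containing both \<open>a\<close> and
    \<open>b\<close> would relate them. Two classes are thus replaced by exactly one.\<close>
  have "?C \<notin> ?D"
  proof
    assume "?C \<in> ?D"
    then obtain x where x: "x \<in> ?V" "?C = ?R `` {x}" by (auto simp: q)
    then have "(x, a) \<in> ?R" "(x, b) \<in> ?R"
      using e eq by (auto simp: equiv_def refl_on_def)
    then show False using ab symR trR by blast
  qed
  then have c1: "card (?V // ?R') = Suc (card ?D)" unfolding Q' using finQ by simp
  have ne: "?R `` {a} \<noteq> ?R `` {b}"
    using ab e eq by (auto simp: equiv_def refl_on_def)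
  have "{?R `` {a}, ?R `` {b}} \<subseteq> ?V // ?R" using e by (auto simp: q)
  then have "card (?V // ?R) = card ?D + 2"
    using finQ ne card_mono[OF finQ, of "{?R `` {a}, ?R `` {b}}"]
    by (simp add: card_Diff_subset)
  moreover have "card (?V // ?R) \<le> card ?V" using card_quotient_conn_rel(2)[OF fin] e(2) by blast
  ultimately show ?thesis using c1 unfolding graphic_rank_def by linarith
qed

lemma connected_card_quotient:
  assumes "connected_multigraph G"
  shows "card (verts G // conn_rel G (edges G)) = 1"
proof -
  obtain u where u: "u \<in> verts G" using assms by (auto simp: connected_multigraph_def)
  have "conn_rel G (edges G) `` {x} = verts G" if "x \<in> verts G" for x
    using assms that by (auto simp: connected_multigraph_def conn_rel_def)
  then have "verts G // conn_rel G (edges G) = {verts G}"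
    using u by (auto simp: quotient_def)
  then show ?thesis by simp
qed

lemma graphic_rank_connected:
  "connected_multigraph G \<Longrightarrow> graphic_rank G (edges G) = card (verts G) - 1"
  by (simp add: graphic_rank_def connected_card_quotient)

lemma graphic_rank_le:
  assumes "finite (verts G)" "verts G \<noteq> {}"
  shows "graphic_rank G A \<le> card (verts G) - 1"
  using card_quotient_conn_rel[OF assms, of A] by (simp add: graphic_rank_def)

lemma connected_contract:
  assumes e: "ends G e = Upair 0 v" "0 \<in> verts G" "v \<in> verts G" "v \<noteq> 0" "e \<in> edges G"
    and con: "connected_multigraph G"
  shows "connected_multigraph (contract_edge G e v)"
proof -
  let ?G' = "contract_edge G e v"
  have "(x, y) \<in> conn_rel ?G' (edges ?G')" if xy: "x \<in> verts ?G'" "y \<in> verts ?G'" for x y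
  proof -
    have "(x, y) \<in> conn_rel G (insert e (edges G - {e}))"
      using con e(5) xy by (auto simp: connected_multigraph_def insert_absorb)
    then show ?thesis
      using conn_rel_contract[OF e(1-4), of x y "edges G - {e}"] xy by (auto simp: merge_root_def)
  qed
  then show ?thesis using e by (auto simp: connected_multigraph_def)
qed

text \<open>If the ends of \<open>e\<close> are connected without it, their classes already
  coincide, so restoring \<open>e\<close> adds no pair to the relation.\<close>

lemma connected_delete:
  assumes e: "ends G e = Upair a b" "a \<in> verts G" "b \<in> verts G" "e \<in> edges G"
    and con: "connected_multigraph G"
  shows "connected_multigraph (delete_edge G e) \<longleftrightarrow> (a, b) \<in> conn_rel G (edges G - {e})"
proof
  assume "connected_multigraph (delete_edge G e)"
  then show "(a, b) \<in> conn_rel G (edges G - {e})" using e by (auto simp: connected_multigraph_def)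
next
  let ?R = "conn_rel G (edges G - {e})"
  assume ab: "(a, b) \<in> ?R"
  have eq: "equiv (verts G) ?R" by (rule equiv_conn_rel)
  have symR: "(x, y) \<in> ?R \<Longrightarrow> (y, x) \<in> ?R" for x y using eq by (meson equiv_def symD)
  have trR: "(x, y) \<in> ?R \<Longrightarrow> (y, z) \<in> ?R \<Longrightarrow> (x, z) \<in> ?R" for x y z
    using eq by (meson equiv_def transD)
  have "conn_rel G (edges G) = ?R \<union> (?R `` {a, b}) \<times> (?R `` {a, b})"
    using conn_rel_insert[OF e(1-3), of "edges G - {e}"] e(4) by (simp add: insert_absorb)
  moreover have "?R `` {a, b} = ?R `` {a}" using equiv_class_eq[OF eq ab] by auto
  moreover have "(?R `` {a}) \<times> (?R `` {a}) \<subseteq> ?R" using trR[OF symR] by blast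
  ultimately have "conn_rel G (edges G) \<subseteq> ?R" by auto
  then show "connected_multigraph (delete_edge G e)"
    using con by (auto simp: connected_multigraph_def)
qed

section \<open>Subset expansion of the Tutte polynomial\<close>

lemma sum_Pow_remove:
  assumes "finite E" "e \<in> E"
  shows "(\<Sum>A\<in>Pow E. F A) = (\<Sum>A\<in>Pow (E - {e}). F A) + (\<Sum>A\<in>Pow (E - {e}). F (insert e A))"
proof -
  have "Pow E = Pow (insert e (E - {e}))" using assms by (simp add: insert_absorb)
  also have "\<dots> = Pow (E - {e}) \<union> insert e ` Pow (E - {e})" by (rule Pow_insert)
  finally have "(\<Sum>A\<in>Pow E. F A) = (\<Sum>A\<in>Pow (E - {e}) \<union> insert e ` Pow (E - {e}). F A)" by simp
  also have "\<dots> = (\<Sum>A\<in>Pow (E - {e}). F A) + (\<Sum>A\<in>insert e ` Pow (E - {e}). F A)"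
    using assms by (intro sum.union_disjoint) auto
  also have "(\<Sum>A\<in>insert e ` Pow (E - {e}). F A) = (\<Sum>A\<in>Pow (E - {e}). F (insert e A))"
    by (subst sum.reindex) (auto simp: inj_on_def)
  finally show ?thesis .
qed

text \<open>This is the binomial expansion of ((y - 1) + 1)^|E|, the Tutte polynomial of a graph
  with loops only.\<close>

lemma sum_Pow_power_card:
  assumes "finite E"
  shows "(\<Sum>A\<in>Pow E. (y - 1) ^ card A) = (y :: 'a :: comm_ring_1) ^ card E"
  using assms
proof (induction E rule: finite_induct)
  case (insert e E)
  have "card (insert e A) = Suc (card A)" if "A \<in> Pow E" for A
    using that insert by (subst card_insert_disjoint) (auto dest: finite_subset)
  then have "(\<Sum>A\<in>Pow E. (y - 1) ^ card (insert e A)) = (y - 1) * (\<Sum>A\<in>Pow E. (y - 1) ^ card A)"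
    by (simp add: sum_distrib_left)
  then show ?case
    using insert sum_Pow_remove[of "insert e E" e "\<lambda>A. (y - 1) ^ card A"]
    by (simp add: algebra_simps)
qed simp

text \<open>Passing from A in the contraction to A with \<open>e\<close> in G raises the rank of A,
  the full rank and the cardinality by one each, so both exponents are unchanged.\<close>

lemma tutte_poly_contract:
  assumes e: "ends G e = Upair 0 v" "0 \<in> verts G" "v \<in> verts G" "v \<noteq> 0" "e \<in> edges G"
    and fin: "finite_multigraph G"
  shows "(\<Sum>A\<in>Pow (edges G - {e}).
      (var_x - 1) ^ (graphic_rank G (edges G) - graphic_rank G (insert e A))
      * (var_y - 1) ^ (card (insert e A) - graphic_rank G (insert e A))) =
    tutte_poly (contract_edge G e v)"
proof -
  have f: "finite (verts G)" "finite (edges G)" using fin by (auto simp: finite_multigraph_def)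
  have "graphic_rank G (edges G) = Suc (graphic_rank (contract_edge G e v) (edges G - {e}))"
    using graphic_rank_contract[OF e(1-4) f(1), of "edges G - {e}"] e(5) by (simp add: insert_absorb)
  moreover have "card (insert e A) = Suc (card A)" if "A \<subseteq> edges G - {e}" for A
    using that f(2) by (subst card_insert_disjoint) (auto dest: finite_subset)
  ultimately show ?thesis unfolding tutte_poly_def
    by (intro sum.cong) (auto simp: graphic_rank_contract[OF e(1-4) f(1)])
qed

lemma tutte_poly_delete_contract:
  assumes e: "ends G e = Upair 0 v" "0 \<in> verts G" "v \<in> verts G" "v \<noteq> 0" "e \<in> edges G"
    and fin: "finite_multigraph G" and con: "connected_multigraph G"
    and del: "connected_multigraph (delete_edge G e)"
  shows "tutte_poly G = tutte_poly (delete_edge G e) + tutte_poly (contract_edge G e v)"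
proof -
  have f: "finite (edges G)" using fin by (auto simp: finite_multigraph_def)
  \<comment> \<open>The exponent of x - 1 involves the full rank, which for connected graphs on the
    same vertices is |V| - 1.\<close>
  have "graphic_rank G (edges G - {e}) = graphic_rank G (edges G)"
    using graphic_rank_connected[OF con] graphic_rank_connected[OF del] by simp
  then have "tutte_poly (delete_edge G e) = (\<Sum>A\<in>Pow (edges G - {e}).
      (var_x - 1) ^ (graphic_rank G (edges G) - graphic_rank G A)
      * (var_y - 1) ^ (card A - graphic_rank G A))"
    by (simp add: tutte_poly_def)
  then show ?thesis
    unfolding tutte_poly_contract[OF e fin, symmetric] tutte_poly_def[of G]
    by (simp add: sum_Pow_remove[OF f e(5)])
qed

text \<open>Adding \<open>e\<close> to A always raises the rank, so the term of A is x - 1 times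
  that of A with \<open>e\<close>. Together the two halves give the factor (x - 1) + 1.\<close>

lemma tutte_poly_bridge:
  assumes e: "ends G e = Upair 0 v" "0 \<in> verts G" "v \<in> verts G" "v \<noteq> 0" "e \<in> edges G"
    and fin: "finite_multigraph G" and con: "connected_multigraph G"
    and del: "\<not> connected_multigraph (delete_edge G e)"
  shows "tutte_poly G = var_x * tutte_poly (contract_edge G e v)"
proof -
  have f: "finite (edges G)" "finite (verts G)" using fin by (auto simp: finite_multigraph_def)
  let ?t = "\<lambda>A. (var_x - 1) ^ (graphic_rank G (edges G) - graphic_rank G A)
      * (var_y - 1) ^ (card A - graphic_rank G A)"
  have t: "?t A = (var_x - 1) * ?t (insert e A)" if A: "A \<in> Pow (edges G - {e})" for A
  proof -
    \<comment> \<open>Connectivity is monotone in the edge set, so no A avoiding \<open>e\<close>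
      can join 0 to \<open>v\<close>.\<close>
    have "conn_rel G A \<subseteq> conn_rel G (edges G - {e})"
      using A unfolding conn_rel_def adj_rel_def by (intro Int_mono rtrancl_mono) auto
    then have "(0, v) \<notin> conn_rel G A" using del connected_delete[OF e(1-3,5) con] by auto
    then have r: "graphic_rank G (insert e A) = Suc (graphic_rank G A)"
      by (rule graphic_rank_insert[OF e(1-3) _ f(2)])
    have "graphic_rank G (insert e A) \<le> graphic_rank G (edges G)"
      unfolding graphic_rank_connected[OF con] using graphic_rank_le[OF f(2)] e(2) by auto
    then have "graphic_rank G (edges G) - graphic_rank G A =
        Suc (graphic_rank G (edges G) - graphic_rank G (insert e A))"
      using r by simp
    moreover have "card (insert e A) = Suc (card A)"
      using A f(1) by (subst card_insert_disjoint) (auto dest: finite_subset)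
    ultimately show ?thesis using r by simp
  qed
  have "tutte_poly G = (\<Sum>A\<in>Pow (edges G - {e}). ?t A) + (\<Sum>A\<in>Pow (edges G - {e}). ?t (insert e A))"
    unfolding tutte_poly_def by (rule sum_Pow_remove[OF f(1) e(5)])
  also have "(\<Sum>A\<in>Pow (edges G - {e}). ?t A) =
      (var_x - 1) * (\<Sum>A\<in>Pow (edges G - {e}). ?t (insert e A))"
    by (simp only: t sum_distrib_left cong: sum.cong)
  finally show ?thesis unfolding tutte_poly_contract[OF e fin] by (simp add: algebra_simps)
qed

section \<open>Deletion and contraction for parking functions\<close>

lemma outdeg_pos_iff:
  assumes "finite_multigraph G"
  shows "0 < outdeg G I v \<longleftrightarrow> (\<exists>e\<in>edges G. \<exists>w. w \<notin> I \<and> ends G e = Upair w v)"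
  using assms unfolding outdeg_def finite_multigraph_def by (auto simp: card_gt_0_iff)

context rooted_multigraph
begin

lemma ends_in_verts: "e \<in> edges G \<Longrightarrow> ends G e = Upair u w \<Longrightarrow> u \<in> verts G \<and> w \<in> verts G"
  using fin by (force simp: finite_multigraph_def)

text \<open>If no edge entered \<open>I\<close>, a path starting at the root could never reach
  it.\<close>

lemma connected_outdeg_pos:
  assumes con: "connected_multigraph G" and I: "I \<subseteq> verts G - {0}" "I \<noteq> {}"
  shows "\<exists>v\<in>I. 0 < outdeg G I v"
proof (rule ccontr)
  assume none: "\<not> ?thesis"
  have "x \<notin> I" if "(0, x) \<in> (adj_rel G (edges G))\<^sup>*" for x
    using that
  proof (induction rule: rtrancl_induct)
    case base
    then show ?case using I by auto
  next
    case (step y z)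
    then show ?case using none outdeg_pos_iff[OF fin, of I z] by (auto simp: adj_rel_def)
  qed
  moreover have "(0, x) \<in> (adj_rel G (edges G))\<^sup>*" if "x \<in> I" for x
    using con root that I unfolding connected_multigraph_def conn_rel_def by blast
  ultimately show False using I by blast
qed

text \<open>In a connected graph the function that vanishes off the root is a parking function. In a
  disconnected one the vertices unreachable from 0 receive no edge from outside, so they violate the
  parking condition for every function.\<close>

lemma parking_functions_nonempty_iff: "parking_functions G \<noteq> {} \<longleftrightarrow> connected_multigraph G"
proof
  assume con: "connected_multigraph G"
  let ?f = "restrict (\<lambda>u. if u = 0 then - 1 else 0) (verts G)"
  have "?f \<in> parking_functions G"
  proof (rule parkingI)
    fix I assume I: "I \<subseteq> verts G - {0}" "I \<noteq> {}"
    then obtain u where "u \<in> I" "0 < outdeg G I u" using connected_outdeg_pos[OF con] by blast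
    then show "\<exists>u\<in>I. ?f u < int (outdeg G I u)" using I by (intro bexI[of _ u]) auto
  qed (use root in auto)
  then show "parking_functions G \<noteq> {}" by blast
next
  assume "parking_functions G \<noteq> {}"
  then obtain f where f: "f \<in> parking_functions G" by blast
  let ?R = "conn_rel G (edges G)"
  let ?I = "{x \<in> verts G. (0, x) \<notin> ?R}"
  have eq: "equiv (verts G) ?R" by (rule equiv_conn_rel)
  have symR: "(x, y) \<in> ?R \<Longrightarrow> (y, x) \<in> ?R" for x y using eq by (meson equiv_def symD)
  have trR: "(x, y) \<in> ?R \<Longrightarrow> (y, z) \<in> ?R \<Longrightarrow> (x, z) \<in> ?R" for x y z
    using eq by (meson equiv_def transD)
  have "?I = {}"
  proof (rule ccontr)
    assume "?I \<noteq> {}"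
    moreover have "?I \<subseteq> verts G - {0}" using root by (auto simp: conn_rel_def)
    ultimately obtain u where u: "u \<in> ?I" "0 \<le> f u" "f u < int (outdeg G ?I u)"
      using parkingD[OF f] by blast
    then have "0 < outdeg G ?I u" by linarith
    then obtain e w where e: "e \<in> edges G" "w \<notin> ?I" "ends G e = Upair w u"
      using outdeg_pos_iff[OF fin] by blast
    then have "w \<in> verts G" "u \<in> verts G" using ends_in_verts by blast+
    then have "(0, w) \<in> ?R" "(w, u) \<in> ?R" using e by (auto simp: conn_rel_def adj_rel_def)
    then show False using trR u(1) by blast
  qed
  then have "(x, y) \<in> ?R" if "x \<in> verts G" "y \<in> verts G" for x y
    using trR[OF symR, of 0 x y] that by blast
  then show "connected_multigraph G" using root by (auto simp: connected_multigraph_def)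
qed

end

text \<open>The inequality in \<open>minimal\<close> is weak because \<open>w\<close> may be
  \<open>v\<close> itself, through \<open>e\<close> or an edge parallel to it.\<close>

locale pivot_edge = rooted_multigraph G for G :: "'e multigraph" +
  fixes \<tau> :: "nat \<Rightarrow> nat" and e :: 'e and v :: nat
  assumes inj_rank: "inj \<tau>"
    and pivot: "ends G e = Upair 0 v" "v \<in> verts G" "v \<noteq> 0" "e \<in> edges G"
    and minimal: "\<And>d w. d \<in> edges G \<Longrightarrow> ends G d = Upair 0 w \<Longrightarrow> w \<noteq> 0 \<Longrightarrow> \<tau> v \<le> \<tau> w"
begin

abbreviation "D \<equiv> delete_edge G e"
abbreviation "C \<equiv> contract_edge G e v"

definition dec :: "(nat \<Rightarrow> int) \<Rightarrow> nat \<Rightarrow> int" where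
  "dec f = f(v := f v - 1)"

definition res :: "(nat \<Rightarrow> int) \<Rightarrow> nat \<Rightarrow> int" where
  "res f = restrict f (verts G - {v})"

lemma dec_apply [simp]: "dec f u = (if u = v then f u - 1 else f u)"
  by (simp add: dec_def)

lemma res_apply: "u \<in> verts G \<Longrightarrow> u \<noteq> v \<Longrightarrow> res f u = f u"
  by (simp add: res_def)

sublocale D: rooted_multigraph D
  using fin root by unfold_locales (auto simp: finite_multigraph_def)

sublocale C: rooted_multigraph C
proof
  show "finite_multigraph C"
    unfolding finite_multigraph_def
  proof (intro conjI ballI)
    fix d assume "d \<in> edges C"
    then have "set_uprod (ends G d) \<subseteq> verts G" using fin by (auto simp: finite_multigraph_def)
    then show "set_uprod (ends C d) \<subseteq> verts C"
      using root pivot by (auto simp: uprod.set_map merge_root_def)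
  qed (use finite_verts finite_edges in auto)
  show "0 \<in> verts C" using root pivot by simp
qed

text \<open>The edge \<open>e\<close> runs from outside \<open>I\<close> to \<open>v\<close>. Its
  loss is exactly compensated by subtracting 1 from the value at \<open>v\<close>, so all
  comparisons of values with outdegrees survive deletion.\<close>

lemma outdeg_delete:
  assumes "0 \<notin> I" "u \<in> I"
  shows "outdeg G I u = outdeg D I u + (if u = v then 1 else 0)"
proof -
  let ?S = "\<lambda>H. {d \<in> edges H. \<exists>w. w \<notin> I \<and> ends H d = Upair w u}"
  have "?S G = ?S D \<union> (if u = v then {e} else {})"
    using pivot assms by (auto simp: Upair_inject)
  moreover have "?S D \<inter> (if u = v then {e} else {}) = {}" by auto
  ultimately show ?thesis unfolding outdeg_def
    using D.finite_edges card_Un_disjoint[of "?S D" "if u = v then {e} else {}"] by auto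
qed

text \<open>Both merged vertices lie outside \<open>I\<close>, so the merger does not affect which
  edges leave \<open>I\<close>.\<close>

lemma outdeg_contract:
  assumes "0 \<notin> I" "v \<notin> I" "u \<in> I"
  shows "outdeg C I u = outdeg G I u"
proof -
  have "{d \<in> edges C. \<exists>w. w \<notin> I \<and> ends C d = Upair w u} =
    {d \<in> edges G. \<exists>w. w \<notin> I \<and> ends G d = Upair w u}"
  proof (intro Collect_cong)
    fix d
    have u: "u \<noteq> 0" "u \<noteq> v" using assms by metis+
    have "(\<exists>w. w \<notin> I \<and> ends C d = Upair w u) \<longleftrightarrow> (\<exists>w. w \<notin> I \<and> ends G d = Upair w u)"
    proof -
      obtain p q where pq: "ends G d = Upair p q" by (metis uprod_exhaust)
      have m: "merge_root v x = u \<longleftrightarrow> x = u" "merge_root v x \<in> I \<longleftrightarrow> x \<in> I" for x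
        using u assms by (auto simp: merge_root_def)
      show ?thesis using m[of p] m[of q] by (auto simp: pq Upair_inject)
    qed
    moreover have "d \<noteq> e" if "ends G d = Upair w u" for w
      using that pivot u by (auto simp: Upair_inject)
    ultimately show "(d \<in> edges C \<and> (\<exists>w. w \<notin> I \<and> ends C d = Upair w u)) \<longleftrightarrow>
      (d \<in> edges G \<and> (\<exists>w. w \<notin> I \<and> ends G d = Upair w u))" by auto
  qed
  then show ?thesis unfolding outdeg_def by simp
qed

lemma outdeg_pivot_pos: "0 \<notin> I \<Longrightarrow> 0 < outdeg G I v"
  using outdeg_pos_iff[OF fin] pivot by blast

lemma outdeg_root_pos:
  assumes "0 < outdeg G (verts G - {0}) w" "w \<noteq> 0"
  shows "\<tau> v \<le> \<tau> w"
proof -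
  obtain d u where d: "d \<in> edges G" "u \<notin> verts G - {0}" "ends G d = Upair u w"
    using assms outdeg_pos_iff[OF fin] by blast
  then have "u = 0" using ends_in_verts by blast
  then show ?thesis using d minimal assms by blast
qed

section \<open>Bijections between parking functions\<close>

lemma dec_parking:
  assumes f: "f \<in> parking_functions G" "1 \<le> f v"
  shows "dec f \<in> parking_functions D"
proof (rule parkingI)
  fix I assume I: "I \<subseteq> verts D - {0}" "I \<noteq> {}"
  then have "0 \<notin> I" by auto
  obtain u where u: "u \<in> I" "f u < int (outdeg G I u)" using parkingD[OF f(1)] I by auto
  then show "\<exists>u\<in>I. dec f u < int (outdeg D I u)"
    using outdeg_delete[OF \<open>0 \<notin> I\<close> u(1)] by (intro bexI[of _ u]) auto
qed (use f parking_extensional[OF f(1)] parking_root[OF f(1)] parking_nonneg[OF f(1)] pivot root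
    in \<open>auto simp: extensional_def\<close>)

lemma inc_parking:
  assumes h: "h \<in> parking_functions D"
  shows "h(v := h v + 1) \<in> parking_functions G"
proof (rule parkingI)
  fix I assume I: "I \<subseteq> verts G - {0}" "I \<noteq> {}"
  then have "0 \<notin> I" by auto
  obtain u where u: "u \<in> I" "h u < int (outdeg D I u)" using parkingD[OF h] I by auto
  then show "\<exists>u\<in>I. (h(v := h v + 1)) u < int (outdeg G I u)"
    using outdeg_delete[OF \<open>0 \<notin> I\<close> u(1)] by (intro bexI[of _ u]) auto
qed (use h parking_extensional[OF h] parking_root[OF h] parking_nonneg[OF h] pivot root
    in \<open>auto simp: extensional_def\<close>)

lemma inc_obtain:
  assumes "h \<in> parking_functions D"
  obtains g where "g \<in> parking_functions G" "1 \<le> g v" "h = dec g"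
proof
  show "h(v := h v + 1) \<in> parking_functions G" using inc_parking[OF assms] .
  show "1 \<le> (h(v := h v + 1)) v" using parking_nonneg[OF assms, of v] pivot by simp
  show "h = dec (h(v := h v + 1))" by auto
qed

lemma bij_betw_dec:
  "bij_betw dec {f \<in> parking_functions G. 1 \<le> f v} (parking_functions D)"
proof (rule bij_betw_imageI)
  show "inj_on dec {f \<in> parking_functions G. 1 \<le> f v}"
  proof (rule inj_onI)
    fix f g assume "dec f = dec g"
    then have "dec f u = dec g u" for u by simp
    then show "f = g" by (intro ext) (metis diff_add_cancel dec_apply)
  qed
  show "dec ` {f \<in> parking_functions G. 1 \<le> f v} = parking_functions D"
    using dec_parking inc_obtain by blast
qed

lemma res_parking:
  assumes f: "f \<in> parking_functions G"
  shows "res f \<in> parking_functions C"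
proof (rule parkingI)
  fix I assume I: "I \<subseteq> verts C - {0}" "I \<noteq> {}"
  then have I': "I \<subseteq> verts G - {0}" "0 \<notin> I" "v \<notin> I" by auto
  then obtain u where u: "u \<in> I" "f u < int (outdeg G I u)" using parkingD[OF f] I by blast
  then show "\<exists>u\<in>I. res f u < int (outdeg C I u)"
    using outdeg_contract[OF I'(2,3) u(1)] I' by (intro bexI[of _ u]) (auto simp: res_def)
qed (use parking_root[OF f] parking_nonneg[OF f] pivot root in \<open>auto simp: res_def\<close>)

lemma extend_parking:
  assumes h: "h \<in> parking_functions C"
  shows "h(v := 0) \<in> parking_functions G"
proof (rule parkingI)
  fix I assume I: "I \<subseteq> verts G - {0}" "I \<noteq> {}"
  have "0 \<notin> I" using I by auto
  show "\<exists>u\<in>I. (h(v := 0)) u < int (outdeg G I u)"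
  proof (cases "v \<in> I")
    case True
    \<comment> \<open>Here \<open>v\<close> itself is the witness: its value is 0 and
      \<open>e\<close> gives it positive outdegree. Sets avoiding \<open>v\<close> are handled in
      the contraction.\<close>
    then show ?thesis using outdeg_pivot_pos[OF \<open>0 \<notin> I\<close>] by (intro bexI[of _ v]) auto
  next
    case False
    then have "I \<subseteq> verts C - {0}" using I by auto
    then obtain u where u: "u \<in> I" "h u < int (outdeg C I u)" using parkingD[OF h] I by blast
    then show ?thesis using outdeg_contract[OF \<open>0 \<notin> I\<close> False u(1)] False by (intro bexI[of _ u]) auto
  qed
qed (use h parking_extensional[OF h] parking_root[OF h] parking_nonneg[OF h] pivot root
    in \<open>auto simp: extensional_def\<close>)

lemma extend_obtain:
  assumes "h \<in> parking_functions C"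
  obtains g where "g \<in> parking_functions G" "g v = 0" "h = res g"
proof
  show "h(v := 0) \<in> parking_functions G" using extend_parking[OF assms] .
  show "(h(v := 0)) v = 0" by simp
  show "h = res (h(v := 0))"
    using parking_extensional[OF assms] by (auto simp: extensional_def restrict_def res_def)
qed

lemma bij_betw_res:
  "bij_betw res {f \<in> parking_functions G. f v = 0} (parking_functions C)"
proof (rule bij_betw_imageI)
  show "inj_on res {f \<in> parking_functions G. f v = 0}"
  proof (rule inj_onI)
    fix f g assume f: "f \<in> {f \<in> parking_functions G. f v = 0}"
      and g: "g \<in> {f \<in> parking_functions G. f v = 0}" and eq: "res f = res g"
    have "f u = g u" if "u \<in> verts G" for u
      using that f g fun_cong[OF eq, of u] by (cases "u = v") (auto simp: res_apply)
    moreover have "f \<in> extensional (verts G)" "g \<in> extensional (verts G)"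
      using f g parking_extensional by auto
    ultimately show "f = g" by (metis extensionalityI)
  qed
  show "res ` {f \<in> parking_functions G. f v = 0} = parking_functions C"
    using res_parking extend_obtain by blast
qed

section \<open>Orders and bridge positions under deletion and contraction\<close>

lemma eligible_delete:
  assumes "0 \<in> P"
  shows "eligible D (dec f) P = eligible G f P"
  using assms outdeg_delete[of "verts G - P"] unfolding eligible_def by auto

text \<open>Having merged \<open>v\<close> into the root has the same effect as having already moved
  it to P.\<close>

lemma eligible_contract:
  assumes "0 \<in> P"
  shows "eligible C (res f) P = eligible G f (insert v P)"
proof -
  have V: "verts C - P = verts G - insert v P" by auto
  have "res f w = f w" "outdeg C (verts G - insert v P) w = outdeg G (verts G - insert v P) w"
    if "w \<in> verts G - insert v P" for w
    using that assms outdeg_contract[OF _ _ that] by (auto simp: res_apply)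
  then show ?thesis unfolding eligible_def V by (intro Collect_cong conj_cong refl) simp
qed

lemma ord_prefix_delete:
  assumes f: "f \<in> parking_functions G" "1 \<le> f v"
  shows "ord_prefix D \<tau> (dec f) k = ord_prefix G \<tau> f k"
proof (induction k)
  case (Suc k)
  show ?case
  proof (cases "k = 0")
    case True
    then show ?thesis
      using next_vertex_root[OF f(1)] D.next_vertex_root[OF dec_parking[OF f]]
      by (simp del: dec_apply)
  next
    case False
    then show ?thesis using Suc eligible_delete root_in_ord_prefix[OF f(1)]
      by (simp add: next_vertex_def del: dec_apply)
  qed
qed simp

lemma ord_prefix_1: "f \<in> parking_functions G \<Longrightarrow> ord_prefix G \<tau> f (Suc 0) = [0]"
  using next_vertex_root by simp

lemma eligible_root:
  assumes g: "g \<in> parking_functions G" and w: "w \<in> eligible G g {0}"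
  shows "w \<noteq> 0" "\<tau> v \<le> \<tau> w"
proof -
  have w': "w \<in> verts G" "g w < int (outdeg G (verts G - {0}) w)" "w \<noteq> 0"
    using w by (auto simp: eligible_def)
  then show "w \<noteq> 0" by simp
  have "0 < outdeg G (verts G - {0}) w" using parking_nonneg[OF g w'(1,3)] w'(2) by linarith
  then show "\<tau> v \<le> \<tau> w" using outdeg_root_pos w'(3) by blast
qed

text \<open>\<open>e\<close> makes \<open>v\<close> eligible, and every vertex eligible after the
  root is a neighbour of 0, hence not ranked before \<open>v\<close>.\<close>

lemma next_vertex_pivot:
  assumes "g \<in> parking_functions G" "g v = 0"
  shows "next_vertex G \<tau> g {0} = v"
  unfolding next_vertex_def
proof (rule arg_min_on_eq[OF inj_rank finite_eligible])
  show "v \<in> eligible G g {0}"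
    using assms pivot outdeg_pivot_pos[of "verts G - {0}"] by (simp add: eligible_def)
qed (use eligible_root[OF assms(1)] in blast)

text \<open>From the time \<open>v\<close> has been moved, the two procedures differ only by
  \<open>v\<close> in P, so they choose the same vertices with positions shifted by one.\<close>

lemma ord_prefix_contract:
  assumes f: "f \<in> parking_functions G" "f v = 0"
  shows "\<exists>xs. ord_prefix G \<tau> f (Suc (Suc k)) = 0 # v # xs \<and> ord_prefix C \<tau> (res f) (Suc k) = 0 # xs"
proof (induction k)
  case 0
  show ?case using next_vertex_root[OF f(1)] next_vertex_pivot[OF f]
      C.next_vertex_root[OF res_parking[OF f(1)]] by simp
next
  case (Suc k)
  then obtain xs where xs: "ord_prefix G \<tau> f (Suc (Suc k)) = 0 # v # xs"
    "ord_prefix C \<tau> (res f) (Suc k) = 0 # xs" by blast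
  have "next_vertex G \<tau> f (set (0 # v # xs)) = next_vertex C \<tau> (res f) (set (0 # xs))"
    using eligible_contract[of "set (0 # xs)" f] by (simp add: next_vertex_def insert_commute)
  then show ?case
    using xs ord_prefix.simps(2)[of G \<tau> f "Suc (Suc k)"] ord_prefix.simps(2)[of C \<tau> "res f" "Suc k"]
    by (metis append_Cons)
qed

text \<open>
  Since \<open>v\<close> has the smallest rank among the neighbours of 0, it comes first as soon as \<open>g v = 0\<close>.
  Hence no function compared with \<open>f\<close> is lost by deleting the edge.
\<close>

lemma weakly_agrees_pos:
  assumes f: "f \<in> parking_functions G" "1 \<le> f v" and i: "0 < i" "i < card (verts G)"
    and g: "weakly_agrees G \<tau> f i g"
  shows "1 \<le> g v"
proof (rule ccontr)
  let ?P = "set (ord_prefix G \<tau> f i)"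
  let ?w = "next_vertex G \<tau> f ?P"
  have gP: "g \<in> parking_functions G" and pre: "ord_prefix G \<tau> g i = ord_prefix G \<tau> f i"
    and gf: "\<forall>u\<in>?P. g u = f u" and gw: "g ?w \<ge> f ?w"
    and low: "\<forall>w \<in> verts G - ?P. \<tau> w < \<tau> ?w \<longrightarrow> g w \<ge> int (outdeg G (verts G - ?P) w)"
    using g by (auto simp: weakly_agrees_def Let_def)
  assume "\<not> 1 \<le> g v"
  then have g0: "g v = 0" using parking_nonneg[OF gP, of v] pivot by simp
  \<comment> \<open>\<open>g\<close> equals \<open>f\<close> on the prefix and is at least
    \<open>f\<close> at the next vertex, but it is smaller than \<open>f\<close> at
    \<open>v\<close>.\<close>
  then have nv: "v \<notin> ?P" "?w \<noteq> v" using gf gw f by auto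
  have g2: "ord_prefix G \<tau> g (Suc (Suc 0)) = [0, v]"
    using next_vertex_root[OF gP] next_vertex_pivot[OF gP g0] by simp
  show False
  proof (cases "i = 1")
    case True
    then have P: "?P = {0}" using ord_prefix_1[OF f(1)] by simp
    have "?w \<in> eligible G f ?P" using next_vertex_eligible(1)[OF f(1) i(2)] .
    then have "\<tau> v \<le> \<tau> ?w" using eligible_root[OF f(1)] P by simp
    \<comment> \<open>The strictly smaller rank subjects \<open>v\<close> to the third condition of
      weak identity, which forces \<open>g v\<close> up to a positive outdegree.\<close>
    then have "\<tau> v < \<tau> ?w" using nv(2) inj_rank by (metis injD le_neq_implies_less)
    then have "g v \<ge> int (outdeg G (verts G - {0}) v)" using low pivot unfolding P by blast
    then show False using g0 outdeg_pivot_pos[of "verts G - {0}"] by simp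
  next
    case False
    \<comment> \<open>The order of \<open>g\<close> begins with 0 and \<open>v\<close>, so the
      common prefix would contain \<open>v\<close>.\<close>
    then have "Suc (Suc 0) \<le> i" using i by simp
    then have "set (ord_prefix G \<tau> g (Suc (Suc 0))) \<subseteq> set (ord_prefix G \<tau> g i)"
      by (rule set_ord_prefix_mono)
    then have "v \<in> ?P" unfolding g2 pre by simp
    then show False using nv by simp
  qed
qed

text \<open>Each clause compares two values at one vertex, or a value with an outdegree; deletion
  shifts both sides equally.\<close>

lemma weakly_agrees_delete:
  assumes f: "f \<in> parking_functions G" "1 \<le> f v" and g: "g \<in> parking_functions G" "1 \<le> g v"
    and i: "0 < i" "i < card (verts G)"
  shows "weakly_agrees D \<tau> (dec f) i (dec g) \<longleftrightarrow> weakly_agrees G \<tau> f i g"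
proof -
  let ?P = "set (ord_prefix G \<tau> f i)"
  have 0: "0 \<in> ?P" using root_in_ord_prefix[OF f(1) i(1)] .
  have nx: "next_vertex D \<tau> (dec f) ?P = next_vertex G \<tau> f ?P"
    using eligible_delete[OF 0] by (simp add: next_vertex_def)
  have val: "dec g u \<ge> int (outdeg D (verts G - ?P) u) \<longleftrightarrow> g u \<ge> int (outdeg G (verts G - ?P) u)"
    if "u \<in> verts G - ?P" for u
    using outdeg_delete[OF _ that] 0 by auto
  have eqs: "dec g u = dec f u \<longleftrightarrow> g u = f u" "dec g u \<ge> dec f u \<longleftrightarrow> g u \<ge> f u" for u by auto
  show ?thesis
    unfolding weakly_agrees_def Let_def ord_prefix_delete[OF f] ord_prefix_delete[OF g] nx eqs
      delete_edge_simps
    using val g dec_parking[OF g] by auto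
qed

lemma bridge_index_delete:
  assumes f: "f \<in> parking_functions G" "1 \<le> f v" and i: "0 < i" "i < card (verts G)"
  shows "bridge_index D \<tau> (dec f) i \<longleftrightarrow> bridge_index G \<tau> f i"
proof -
  let ?P = "set (ord_prefix G \<tau> f i)"
  let ?w = "next_vertex G \<tau> f ?P"
  have 0: "0 \<in> ?P" using root_in_ord_prefix[OF f(1) i(1)] .
  have nx: "next_vertex D \<tau> (dec g) ?P = next_vertex G \<tau> g ?P" for g
    using eligible_delete[OF 0] by (simp add: next_vertex_def)
  have "?w \<in> verts G - ?P" using next_vertex_eligible(1)[OF f(1) i(2)] by (simp add: eligible_def)
  then have crit: "dec f ?w = int (outdeg D (verts G - ?P) ?w) - 1 \<longleftrightarrow>
      f ?w = int (outdeg G (verts G - ?P) ?w) - 1"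
    using outdeg_delete[of "verts G - ?P" ?w] 0 by auto
  have "(\<forall>h. weakly_agrees D \<tau> (dec f) i h \<longrightarrow> next_vertex D \<tau> h ?P = ?w) \<longleftrightarrow>
      (\<forall>g. weakly_agrees G \<tau> f i g \<longrightarrow> next_vertex G \<tau> g ?P = ?w)"
  proof (intro iffI allI impI)
    fix g assume L: "\<forall>h. weakly_agrees D \<tau> (dec f) i h \<longrightarrow> next_vertex D \<tau> h ?P = ?w"
      and g: "weakly_agrees G \<tau> f i g"
    have gP: "g \<in> parking_functions G" using g by (simp add: weakly_agrees_def Let_def)
    \<comment> \<open>\<open>weakly_agrees_pos\<close> provides \<open>g v \<ge> 1\<close>, without
      which \<open>g\<close> would have no counterpart in G - e.\<close>
    have "weakly_agrees D \<tau> (dec f) i (dec g)"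
      using weakly_agrees_delete[OF f gP weakly_agrees_pos[OF f i g] i] g by simp
    then show "next_vertex G \<tau> g ?P = ?w" using L nx by metis
  next
    fix h assume R: "\<forall>g. weakly_agrees G \<tau> f i g \<longrightarrow> next_vertex G \<tau> g ?P = ?w"
      and h: "weakly_agrees D \<tau> (dec f) i h"
    have "h \<in> parking_functions D" using h by (simp add: weakly_agrees_def Let_def)
    then obtain g where g: "g \<in> parking_functions G" "1 \<le> g v" "h = dec g" by (rule inc_obtain)
    then show "next_vertex D \<tau> h ?P = ?w"
      using R weakly_agrees_delete[OF f g(1,2) i] h nx by metis
  qed
  then show ?thesis
    unfolding bridge_index_def Let_def ord_prefix_delete[OF f] nx delete_edge_simps crit by simp
qed

lemma weakly_agrees_contract:
  assumes f: "f \<in> parking_functions G" "f v = 0" and g: "g \<in> parking_functions G" "g v = 0"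
    and i: "0 < i" "Suc i < card (verts G)"
  shows "weakly_agrees C \<tau> (res f) i (res g) \<longleftrightarrow> weakly_agrees G \<tau> f (Suc i) g"
proof -
  let ?P = "set (ord_prefix G \<tau> f (Suc i))"
  let ?P' = "set (ord_prefix C \<tau> (res f) i)"
  obtain k where k: "i = Suc k" using i by (cases i) auto
  obtain xs where xs: "ord_prefix G \<tau> f (Suc i) = 0 # v # xs" "ord_prefix C \<tau> (res f) i = 0 # xs"
    using ord_prefix_contract[OF f] k by blast
  obtain ys where ys: "ord_prefix G \<tau> g (Suc i) = 0 # v # ys" "ord_prefix C \<tau> (res g) i = 0 # ys"
    using ord_prefix_contract[OF g] k by blast
  have cC: "i < card (verts C)" using i pivot finite_verts by simp
  have P: "?P = insert v ?P'" "0 \<in> ?P'" unfolding xs by auto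
  have P': "?P' \<subseteq> verts G - {v}"
    using C.ord_prefix_subset[OF res_parking[OF f(1)], of i \<tau>] cC by auto
  have nx: "next_vertex C \<tau> (res f) ?P' = next_vertex G \<tau> f ?P"
    using eligible_contract[OF P(2)] P(1) by (simp add: next_vertex_def)
  let ?w = "next_vertex G \<tau> f ?P"
  have w: "?w \<in> verts G - ?P"
    using next_vertex_eligible(1)[OF f(1) i(2), of \<tau>] by (simp add: eligible_def)
  then have wv: "?w \<in> verts G" "?w \<noteq> v" using P by auto
  have V: "verts C - ?P' = verts G - ?P" using P by auto
  have a: "ord_prefix C \<tau> (res g) i = ord_prefix C \<tau> (res f) i \<longleftrightarrow>
      ord_prefix G \<tau> g (Suc i) = ord_prefix G \<tau> f (Suc i)" unfolding xs ys by simp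
  \<comment> \<open>The prefix in G additionally contains \<open>v\<close>, where both functions are
    0.\<close>
  have b: "(\<forall>u\<in>?P'. res g u = res f u) \<longleftrightarrow> (\<forall>u\<in>?P. g u = f u)"
    using P P' f g by (auto simp: res_apply subset_iff)
  have c: "(\<forall>u \<in> verts G - ?P. \<tau> u < \<tau> ?w \<longrightarrow> int (outdeg C (verts G - ?P) u) \<le> res g u) \<longleftrightarrow>
      (\<forall>u \<in> verts G - ?P. \<tau> u < \<tau> ?w \<longrightarrow> int (outdeg G (verts G - ?P) u) \<le> g u)"
  proof (intro ball_cong refl)
    fix u assume u: "u \<in> verts G - ?P"
    then have "outdeg C (verts G - ?P) u = outdeg G (verts G - ?P) u"
      using P by (intro outdeg_contract) auto
    moreover have "res g u = g u" using u P by (intro res_apply) auto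
    ultimately show "(\<tau> u < \<tau> ?w \<longrightarrow> int (outdeg C (verts G - ?P) u) \<le> res g u) \<longleftrightarrow>
      (\<tau> u < \<tau> ?w \<longrightarrow> int (outdeg G (verts G - ?P) u) \<le> g u)" by simp
  qed
  show ?thesis
    unfolding weakly_agrees_def Let_def nx V a b c res_apply[OF wv]
    using g res_parking[OF g(1)] by simp
qed

lemma bridge_index_contract:
  assumes f: "f \<in> parking_functions G" "f v = 0" and i: "0 < i" "Suc i < card (verts G)"
  shows "bridge_index C \<tau> (res f) i \<longleftrightarrow> bridge_index G \<tau> f (Suc i)"
proof -
  let ?P = "set (ord_prefix G \<tau> f (Suc i))"
  let ?P' = "set (ord_prefix C \<tau> (res f) i)"
  let ?w = "next_vertex G \<tau> f ?P"
  obtain k where k: "i = Suc k" using i by (cases i) auto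
  obtain xs where xs: "ord_prefix G \<tau> f (Suc i) = 0 # v # xs" "ord_prefix C \<tau> (res f) i = 0 # xs"
    using ord_prefix_contract[OF f] k by blast
  have P: "?P = insert v ?P'" "0 \<in> ?P'" unfolding xs by auto
  have nx: "next_vertex C \<tau> (res g) ?P' = next_vertex G \<tau> g ?P" for g
    using eligible_contract[OF P(2)] P(1) by (simp add: next_vertex_def)
  have w: "?w \<in> verts G - ?P"
    using next_vertex_eligible(1)[OF f(1) i(2), of \<tau>] by (simp add: eligible_def)
  have V: "verts C - ?P' = verts G - ?P" using P by auto
  have "outdeg C (verts G - ?P) ?w = outdeg G (verts G - ?P) ?w"
    using P w by (intro outdeg_contract) auto
  moreover have "res f ?w = f ?w" using w P by (intro res_apply) auto
  ultimately have crit: "res f ?w = int (outdeg C (verts G - ?P) ?w) - 1 \<longleftrightarrow>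
      f ?w = int (outdeg G (verts G - ?P) ?w) - 1" by simp
  have "(\<forall>h. weakly_agrees C \<tau> (res f) i h \<longrightarrow> next_vertex C \<tau> h ?P' = ?w) \<longleftrightarrow>
      (\<forall>g. weakly_agrees G \<tau> f (Suc i) g \<longrightarrow> next_vertex G \<tau> g ?P = ?w)"
  proof (intro iffI allI impI)
    fix g assume L: "\<forall>h. weakly_agrees C \<tau> (res f) i h \<longrightarrow> next_vertex C \<tau> h ?P' = ?w"
      and g: "weakly_agrees G \<tau> f (Suc i) g"
    have gP: "g \<in> parking_functions G" "\<forall>u\<in>?P. g u = f u"
      using g by (auto simp: weakly_agrees_def Let_def)
    \<comment> \<open>From position 2 on, \<open>v\<close> belongs to the prefix, so every
      comparison function inherits the value 0 there and descends to the contraction.\<close>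
    then have "g v = 0" using f(2) P(1) by (metis insertI1)
    then have "weakly_agrees C \<tau> (res f) i (res g)"
      using weakly_agrees_contract[OF f gP(1) _ i] g by simp
    then show "next_vertex G \<tau> g ?P = ?w" using L nx by metis
  next
    fix h assume R: "\<forall>g. weakly_agrees G \<tau> f (Suc i) g \<longrightarrow> next_vertex G \<tau> g ?P = ?w"
      and h: "weakly_agrees C \<tau> (res f) i h"
    have "h \<in> parking_functions C" using h by (simp add: weakly_agrees_def Let_def)
    then obtain g where g: "g \<in> parking_functions G" "g v = 0" "h = res g" by (rule extend_obtain)
    then show "next_vertex C \<tau> h ?P' = ?w"
      using R weakly_agrees_contract[OF f g(1,2) i] h nx by metis
  qed
  then show ?thesis unfolding bridge_index_def Let_def nx V crit by simp
qed

lemma connected_delete_iff: "connected_multigraph D \<longleftrightarrow> (\<exists>g\<in>parking_functions G. 1 \<le> g v)"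
  using D.parking_functions_nonempty_iff dec_parking inc_obtain by blast

lemma bridge_index_pivot:
  assumes f: "f \<in> parking_functions G" "f v = 0"
  shows "bridge_index G \<tau> f (Suc 0) \<longleftrightarrow> \<not> connected_multigraph D"
proof -
  have P: "ord_prefix G \<tau> g (Suc 0) = [0]" if "g \<in> parking_functions G" for g
    using ord_prefix_1[OF that] .
  have V: "0 \<notin> verts G - {0}" "v \<in> verts G - {0}" using pivot by auto
  \<comment> \<open>With \<open>f v = 0\<close>, criticality means outdegree 1, that is,
    \<open>e\<close> is the only edge between 0 and \<open>v\<close>.\<close>
  have bi: "bridge_index G \<tau> f (Suc 0) \<longleftrightarrow> outdeg D (verts G - {0}) v = 0 \<and>
      (\<forall>g. weakly_agrees G \<tau> f (Suc 0) g \<longrightarrow> next_vertex G \<tau> g {0} = v)"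
    unfolding bridge_index_def Let_def P[OF f(1)]
    using next_vertex_pivot[OF f] f(2) outdeg_delete[OF V] by simp
  show ?thesis
  proof (cases "connected_multigraph D")
    case True
    then obtain g where g: "g \<in> parking_functions G" "1 \<le> g v" using connected_delete_iff by blast
    have "\<not> bridge_index G \<tau> f (Suc 0)"
    proof
      assume B: "bridge_index G \<tau> f (Suc 0)"
      \<comment> \<open>Vertices ranked before \<open>v\<close> are not adjacent to 0, so the third
        condition of weak identity only asks for nonnegative values. Thus \<open>g\<close> is a
        comparison function, and the bridge property would make \<open>v\<close> eligible for it,
        although \<open>g v \<ge> 1\<close> and the outdegree is 1.\<close>
      have "int (outdeg G (verts G - {0}) w) \<le> g w" if w: "w \<in> verts G - {0}" "\<tau> w < \<tau> v" for w
      proof -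
        have "outdeg G (verts G - {0}) w = 0" using outdeg_root_pos[of w] w by fastforce
        then show ?thesis using parking_nonneg[OF g(1), of w] w by simp
      qed
      then have "weakly_agrees G \<tau> f (Suc 0) g"
        unfolding weakly_agrees_def Let_def P[OF f(1)] P[OF g(1)]
        using g next_vertex_pivot[OF f] f parking_root[OF f(1)] parking_root[OF g(1)] by auto
      then have "next_vertex G \<tau> g {0} = v" using B bi by blast
      moreover have "Suc 0 < card (verts G)"
        using card_mono[OF finite_verts, of "{0, v}"] root pivot by auto
      then have "next_vertex G \<tau> g {0} \<in> eligible G g {0}"
        using next_vertex_eligible(1)[OF g(1), of "Suc 0" \<tau>] P[OF g(1)] by simp
      ultimately have "g v < int (outdeg G (verts G - {0}) v)" by (simp add: eligible_def)
      then show False using g(2) B bi outdeg_delete[OF V] by simp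
    qed
    then show ?thesis using True by simp
  next
    case False
    have "outdeg D (verts G - {0}) v = 0"
    proof (rule ccontr)
      assume "outdeg D (verts G - {0}) v \<noteq> 0"
      then obtain d u where d: "d \<in> edges D" "u \<notin> verts G - {0}" "ends D d = Upair u v"
        using outdeg_pos_iff[OF D.fin] by blast
      then have "u = 0" using D.ends_in_verts[OF d(1,3)] by auto
      then have dec1: "int (outdeg D I v) > 0" if "0 \<notin> I" for I
        using outdeg_pos_iff[OF D.fin, of I v] d that by auto
      \<comment> \<open>A second edge between 0 and \<open>v\<close> gives \<open>v\<close>
        outdegree at least 2 in every set without 0, which leaves room for the value 1; then G - e
        would be connected.\<close>
      have "f(v := 1) \<in> parking_functions G"
      proof (rule parkingI)
        fix I assume I: "I \<subseteq> verts G - {0}" "I \<noteq> {}"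
        then have I0: "0 \<notin> I" by auto
        obtain u where u: "u \<in> I" "f u < int (outdeg G I u)" using parkingD[OF f(1) I] by blast
        show "\<exists>u\<in>I. (f(v := 1)) u < int (outdeg G I u)"
        proof (cases "v \<in> I")
          case True
          then show ?thesis
            using dec1[OF I0] outdeg_delete[OF I0 True] by (intro bexI[of _ v]) auto
        next
          case False
          then show ?thesis using u by (intro bexI[of _ u]) auto
        qed
      qed (use f parking_extensional[OF f(1)] parking_root[OF f(1)] parking_nonneg[OF f(1)] pivot root
          in \<open>auto simp: extensional_def\<close>)
      then show False using False connected_delete_iff by (metis fun_upd_same order_refl)
    qed
    moreover have "next_vertex G \<tau> g {0} = v" if "weakly_agrees G \<tau> f (Suc 0) g" for g
    proof -
      have g: "g \<in> parking_functions G" using that by (simp add: weakly_agrees_def Let_def)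
      then have "\<not> 1 \<le> g v" using False connected_delete_iff by blast
      then have "g v = 0" using parking_nonneg[OF g, of v] pivot by simp
      then show ?thesis using next_vertex_pivot[OF g] by simp
    qed
    ultimately show ?thesis using False bi by blast
  qed
qed

section \<open>Bridge counts, weights and the recursion of the enumerator\<close>

lemma bridge_count_delete:
  assumes "f \<in> parking_functions G" "1 \<le> f v"
  shows "bridge_count D \<tau> (dec f) = bridge_count G \<tau> f"
  unfolding bridge_count_eq[OF assms(1)] D.bridge_count_eq[OF dec_parking[OF assms]]
  using bridge_index_delete[OF assms] by (intro arg_cong[where f = card]) auto

text \<open>Position i of the contraction corresponds to position i + 1 of G for positive i.
  Position 1 of G is that of \<open>v\<close> and accounts for the extra term.\<close>

lemma bridge_count_contract:
  assumes f: "f \<in> parking_functions G" "f v = 0"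
  shows "bridge_count G \<tau> f =
    bridge_count C \<tau> (res f) + (if connected_multigraph D then 0 else 1)"
proof -
  let ?S = "{i \<in> {1..<card (verts C)}. bridge_index C \<tau> (res f) i}"
  let ?T = "if connected_multigraph D then {} else {Suc 0}"
  have card: "card (verts G) = Suc (card (verts C))"
    using card_Suc_Diff1[OF finite_verts pivot(2)] by simp
  have pos: "0 < card (verts C)" using C.root C.finite_verts by (auto simp: card_gt_0_iff)
  have "{i \<in> {1..<card (verts G)}. bridge_index G \<tau> f i} = Suc ` ?S \<union> ?T"
  proof (intro set_eqI)
    fix j
    consider "j = 0" | "j = Suc 0" | i where "j = Suc i" "0 < i"
      by (metis neq0_conv not0_implies_Suc)
    then show "j \<in> {i \<in> {1..<card (verts G)}. bridge_index G \<tau> f i} \<longleftrightarrow> j \<in> Suc ` ?S \<union> ?T"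
    proof cases
      case 1
      then show ?thesis by auto
    next
      case 2
      then show ?thesis using bridge_index_pivot[OF f] card pos by auto
    next
      case 3
      then show ?thesis using bridge_index_contract[OF f, of i] card by auto
    qed
  qed
  moreover have "card (Suc ` ?S \<union> ?T) = card (Suc ` ?S) + card ?T"
    by (rule card_Un_disjoint) auto
  moreover have "card (Suc ` ?S) = card ?S" by (simp add: card_image)
  ultimately show ?thesis
    unfolding bridge_count_eq[OF f(1)] C.bridge_count_eq[OF res_parking[OF f(1)]] by simp
qed

text \<open>The number of edges and the sum of the values both drop by 1.\<close>

lemma pf_weight_delete: "pf_weight D (dec f) = pf_weight G f"
proof -
  have "(\<Sum>u\<in>verts G. dec f u) = (\<Sum>u\<in>verts G. f u) - 1"
    using finite_verts pivot by (simp add: sum.remove[of _ v])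
  moreover have "card (edges G) = Suc (card (edges D))"
    using card_Suc_Diff1[OF finite_edges pivot(4)] by simp
  ultimately show ?thesis by (simp add: pf_weight_def)
qed

text \<open>One edge and one vertex disappear, and the value lost at \<open>v\<close> is 0.\<close>

lemma pf_weight_contract:
  assumes "f v = 0"
  shows "pf_weight C (res f) = pf_weight G f"
proof -
  have "(\<Sum>u\<in>verts G. f u) = (\<Sum>u\<in>verts C. res f u)"
  proof -
    have "(\<Sum>u\<in>verts G. f u) = (\<Sum>u\<in>verts G - {v}. f u)"
      using sum.remove[OF finite_verts pivot(2), of f] assms by simp
    also have "\<dots> = (\<Sum>u\<in>verts G - {v}. res f u)" by (intro sum.cong) (auto simp: res_apply)
    finally show ?thesis by simp
  qed
  moreover have "card (edges G) = Suc (card (edges C))"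
    using card_Suc_Diff1[OF finite_edges pivot(4)] by simp
  moreover have "card (verts G) = Suc (card (verts C))"
    using card_Suc_Diff1[OF finite_verts pivot(2)] by simp
  ultimately show ?thesis by (simp add: pf_weight_def)
qed

end

text \<open>\<open>nat\<close> would send a negative weight to exponent 0; nonnegativity of the
  weights is therefore proved alongside the identity.\<close>

definition parking_enumerator :: "'e multigraph \<Rightarrow> (nat \<Rightarrow> nat) \<Rightarrow> int poly poly" where
  "parking_enumerator G \<tau> =
     (\<Sum>f\<in>parking_functions G. var_x ^ bridge_count G \<tau> f * var_y ^ nat (pf_weight G f))"

context pivot_edge
begin

lemma parking_functions_split:
  "parking_functions G = {f \<in> parking_functions G. 1 \<le> f v} \<union> {f \<in> parking_functions G. f v = 0}"
proof -
  have "1 \<le> f v \<or> f v = 0" if "f \<in> parking_functions G" for f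
    using parking_nonneg[OF that pivot(2,3)] by linarith
  then show ?thesis by blast
qed

lemma parking_enumerator_delete_contract:
  "parking_enumerator G \<tau> = parking_enumerator D \<tau> +
     (if connected_multigraph D then 1 else var_x) * parking_enumerator C \<tau>"
proof -
  let ?F = "\<lambda>H f. var_x ^ bridge_count H \<tau> f * var_y ^ nat (pf_weight H f)"
  let ?A = "{f \<in> parking_functions G. 1 \<le> f v}"
  let ?B = "{f \<in> parking_functions G. f v = 0}"
  have "parking_enumerator G \<tau> = (\<Sum>f\<in>?A \<union> ?B. ?F G f)"
    unfolding parking_enumerator_def using parking_functions_split by simp
  also have "\<dots> = (\<Sum>f\<in>?A. ?F G f) + (\<Sum>f\<in>?B. ?F G f)"
    using finite_parking_functions by (intro sum.union_disjoint) auto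
  also have "(\<Sum>f\<in>?A. ?F G f) = (\<Sum>f\<in>?A. ?F D (dec f))"
    by (intro sum.cong) (auto simp: bridge_count_delete pf_weight_delete)
  also have "\<dots> = parking_enumerator D \<tau>"
    unfolding parking_enumerator_def by (rule sum.reindex_bij_betw[OF bij_betw_dec])
  also have "(\<Sum>f\<in>?B. ?F G f) =
      (\<Sum>f\<in>?B. (if connected_multigraph D then 1 else var_x) * ?F C (res f))"
    by (intro sum.cong) (auto simp: bridge_count_contract pf_weight_contract)
  also have "\<dots> = (if connected_multigraph D then 1 else var_x) * (\<Sum>f\<in>?B. ?F C (res f))"
    by (rule sum_distrib_left[symmetric])
  also have "(\<Sum>f\<in>?B. ?F C (res f)) = parking_enumerator C \<tau>"
    unfolding parking_enumerator_def by (rule sum.reindex_bij_betw[OF bij_betw_res])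
  finally show ?thesis .
qed

lemma pf_weight_nonneg_step:
  assumes "\<forall>h\<in>parking_functions D. 0 \<le> pf_weight D h" "\<forall>h\<in>parking_functions C. 0 \<le> pf_weight C h"
    and f: "f \<in> parking_functions G"
  shows "0 \<le> pf_weight G f"
proof (cases "1 \<le> f v")
  case True
  then show ?thesis using assms(1) dec_parking[OF f] pf_weight_delete[of f] by metis
next
  case False
  then have "f v = 0" using parking_nonneg[OF f, of v] pivot by simp
  then show ?thesis using assms(2) res_parking[OF f] pf_weight_contract[of f] by metis
qed

end

section \<open>Graphs with one vertex and the induction\<close>

lemma (in rooted_multigraph) tutte_poly_single_vertex:
  assumes V: "verts G = {0}"
  shows "(\<forall>f\<in>parking_functions G. 0 \<le> pf_weight G f) \<and> tutte_poly G = parking_enumerator G \<tau>"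
proof -
  define f0 :: "nat \<Rightarrow> int" where "f0 = restrict (\<lambda>_. - 1) {0}"
  have "f u = f0 u" if "f \<in> parking_functions G" for f u
    using parking_root[OF that] extensional_arb[OF parking_extensional[OF that], of u] V
    by (cases "u = 0") (auto simp: f0_def)
  then have sub: "parking_functions G \<subseteq> {f0}" by blast
  have mem: "f0 \<in> parking_functions G" unfolding f0_def using V by (intro parkingI) auto
  have P: "parking_functions G = {f0}" using sub mem by blast
  \<comment> \<open>The value -1 at the root cancels the single vertex in |E| - |V| - sum.\<close>
  have wt: "pf_weight G f0 = int (card (edges G))"
    by (simp add: pf_weight_def V f0_def)
  have "bridge_count G \<tau> f0 = 0" using bridge_count_eq[OF mem] V by simp
  then have "parking_enumerator G \<tau> = var_y ^ card (edges G)"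
    unfolding parking_enumerator_def P by (simp add: wt)
  moreover have r: "graphic_rank G A = 0" for A
    using graphic_rank_le[OF finite_verts, of A] V by simp
  have "tutte_poly G = var_y ^ card (edges G)"
    unfolding tutte_poly_def r using sum_Pow_power_card[OF finite_edges, of var_y] by simp
  ultimately show ?thesis using P wt by simp
qed

text \<open>Deletion and contraction each remove one edge, which drives the induction. The ranking
  stays fixed while the vertex labels change, so it is only required to be injective.\<close>

lemma tutte_poly_eq_parking_enumerator:
  assumes "finite_multigraph G" "connected_multigraph G" "0 \<in> verts G" "inj \<tau>"
  shows "(\<forall>f\<in>parking_functions G. 0 \<le> pf_weight G f) \<and> tutte_poly G = parking_enumerator G \<tau>"
  using assms(1-3)
proof (induction "card (edges G)" arbitrary: G rule: less_induct)
  case less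
  interpret rooted_multigraph G using less.prems by unfold_locales
  let ?N = "{w. w \<noteq> 0 \<and> (\<exists>d\<in>edges G. ends G d = Upair 0 w)}"
  show ?case
  proof (cases "?N = {}")
    case True
    \<comment> \<open>If 0 has no neighbours, no edge enters the remaining vertices, so
      connectedness leaves none.\<close>
    have "verts G = {0}"
    proof (rule ccontr)
      assume "verts G \<noteq> {0}"
      then have "verts G - {0} \<noteq> {}" using root by blast
      then obtain w where w: "w \<in> verts G - {0}" "0 < outdeg G (verts G - {0}) w"
        using connected_outdeg_pos[OF less.prems(2), of "verts G - {0}"] by blast
      then obtain d u where d: "d \<in> edges G" "u \<notin> verts G - {0}" "ends G d = Upair u w"
        using outdeg_pos_iff[OF fin] by blast
      then have "u = 0" using ends_in_verts by blast
      then show False using True d w by blast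
    qed
    then show ?thesis by (rule tutte_poly_single_vertex)
  next
    case False
    define v where "v = arg_min_on \<tau> ?N"
    have "?N \<subseteq> verts G" using ends_in_verts by blast
    then have finN: "finite ?N" using finite_verts finite_subset by blast
    then have "v \<in> ?N" unfolding v_def using False by (rule arg_min_on_in)
    then obtain e where e: "e \<in> edges G" "ends G e = Upair 0 v" "v \<noteq> 0" by blast
    have vV: "v \<in> verts G" using ends_in_verts[OF e(1,2)] by simp
    interpret pivot_edge G \<tau> e v
    proof unfold_locales
      fix d w assume "d \<in> edges G" "ends G d = Upair 0 w" "w \<noteq> 0"
      then show "\<tau> v \<le> \<tau> w" unfolding v_def using finN by (intro arg_min_least) auto
    qed (use e vV assms(4) in auto)
    have card: "card (edges D) < card (edges G)" "card (edges C) < card (edges G)"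
      using card_Suc_Diff1[OF finite_edges e(1)] by auto
    have conC: "connected_multigraph C"
      using connected_contract[OF e(2) root pivot(2,3) e(1) less.prems(2)] .
    have IHC: "(\<forall>f\<in>parking_functions C. 0 \<le> pf_weight C f) \<and> tutte_poly C = parking_enumerator C \<tau>"
      using less.hyps[OF card(2) C.fin conC C.root] .
    show ?thesis
    proof (cases "connected_multigraph D")
      case True
      have IHD: "(\<forall>f\<in>parking_functions D. 0 \<le> pf_weight D f) \<and> tutte_poly D = parking_enumerator D \<tau>"
        using less.hyps[OF card(1) D.fin True D.root] .
      show ?thesis
        using tutte_poly_delete_contract[OF e(2) root pivot(2,3) e(1) fin less.prems(2) True]
          parking_enumerator_delete_contract IHD IHC True pf_weight_nonneg_step by simp
    next
      case False
      \<comment> \<open>The summand of G - e in the enumerator is now an empty sum, leaving x times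
        the enumerator of the contraction.\<close>
      then have "parking_functions D = {}" using D.parking_functions_nonempty_iff by blast
      then show ?thesis
        using tutte_poly_bridge[OF e(2) root pivot(2,3) e(1) fin less.prems(2) False]
          parking_enumerator_delete_contract IHC False pf_weight_nonneg_step
        by (simp add: parking_enumerator_def[of D])
    qed
  qed
qed

theorem theorem3p3:
  fixes G :: "'e multigraph" and n :: nat and \<tau> :: "nat \<Rightarrow> nat"
  assumes "finite_multigraph G"
    and "connected_multigraph G"
    and "verts G = {0..n}"
    and "\<tau> permutes {1..n}"
  shows "(\<forall>f\<in>parking_functions G. 0 \<le> pf_weight G f) \<and>
    tutte_poly G =
      (\<Sum>f\<in>parking_functions G. var_x ^ bridge_count G \<tau> f * var_y ^ nat (pf_weight G f))"
  \<comment> \<open>A permutation of {1..n} fixes all other numbers, hence is injective on all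
    naturals.\<close>
  using tutte_poly_eq_parking_enumerator[OF assms(1,2) _ permutes_inj[OF assms(4)]] assms(3)
  by (simp add: parking_enumerator_def)

end
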